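(* Let $K/\mathbb Q$ be a finite Galois extension with ring of integers $\mathcal O$, and let $\sigma\in{\rm Gal}(K/\mathbb Q)$. Then for all $z\in\mathbb K$ and all $\mu,\nu,\iota\in\mathbb P\mathbb K_{{\rm N}(\varepsilon)}$, $$\sigma\big({}^*\mathcal O^{\mu[\iota]}_\nu(z)\big)={}^*\mathcal O^{\sigma(\mu)[\sigma(\iota)]}_{\sigma(\nu)}(\sigma(z)).$$ In particular, for $z,w\in\mathbb K$ and $\mu,\nu\in\mathbb P\mathbb K_{{\rm N}(\varepsilon)}$: $z$ is $(\mu,\nu)$-composable with $w$ if and only if $\sigma(z)$ is $(\sigma(\mu),\sigma(\nu))$-composable with $\sigma(w)$; and for $\alpha,\beta\in{}^*\mathcal O$, one has $\alpha\in{}^*\mathcal O^\mu_\nu(z)$ and $\beta\in{}^*\mathcal O^\nu_\mu(w)$ if and only if $\sigma(\alpha)\in{}^*\mathcal O^{\sigma(\mu)}_{\sigma(\nu)}(\sigma(z))$ and $\sigma(\beta)\in{}^*\mathcal O^{\sigma(\nu)}_{\sigma(\mu)}(\sigma(w))$. Therefore the status of an element as an $\mathcal O$-fast, $\mathcal O$-slow, $\mathcal O$-flat or $\mathcal O$-oscillatory divisor is preserved by the action of $\sigma$ (if $z$ has the given status as divisor of $zw$, then $\sigma(z)$ has it as divisor of $\sigma(z)\sigma(w)$).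
   Context: Fix a nonprincipal ultrafilter on $\mathbb N$ and denote ultrapowers with ${}^*$. Let ${}^*\mathbb R_{\rm fin}$ be the bounded elements of ${}^*\mathbb R$ and $({}^*\mathbb R_{\rm fin})^\times_+$ the positive elements neither infinite nor infinitesimal. Let $\mathbb P:=({}^*\mathbb R_{>0}\cup\{0\})/({}^*\mathbb R_{\rm fin})^\times_+$, with induced product and total order, $-\infty:=$ class of $0$ (the minimum); for $x\in{}^*\mathbb C$ let $\langle x\rangle\in\mathbb P$ be the class of $|x|$. Let $d=[K:\mathbb Q]$. The Minkowski space is $\mathbb K:=\{z=(z_\tau)\in\mathbb C^d:\overline{z_\tau}=z_{\overline\tau}\}$, coordinates indexed by the $d$ embeddings $\tau:K\hookrightarrow\mathbb C$. $K$ is embedded in $\mathbb K$ by $\alpha\mapsto(\tau(\alpha))_\tau$, so ${}^*\mathcal O\subset{}^*\mathbb K$. ${}^*\mathbb K_\varepsilon$ is the set of elements of ${}^*\mathbb K$ with all coordinates infinitesimal (possibly zero). $\mathbb P\mathbb K$ is the set of tuples $(\mu_\tau)\in\mathbb P^d$ with $\mu_\tau=\mu_{\overline\tau}$, with coordinatewise product; for $z\in{}^*\mathbb K$ write $\langle z\rangle=(\langle z_\tau\rangle)_\tau\in\mathbb P\mathbb K$. Write $\mu\le\mu'$ (resp. $\mu<\mu'$) if the inequality (resp. strict inequality) holds in every coordinate. $\mathbb P\mathbb K_\varepsilon$ is the image of ${}^*\mathbb K_\varepsilon$, and $\mathbb P\mathbb K_{{\rm N}(\varepsilon)}:=\{\mu\in\mathbb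 P\mathbb K:\prod_\tau\mu_\tau\text{ is the class of an infinitesimal (possibly }0)\}$. For $z\in\mathbb K$, ${}^*\mathcal O(z)$ is the group of $\alpha\in{}^*\mathcal O$ for which there is a (unique) $\alpha^\perp\in{}^*\mathcal O$ with $\varepsilon(\alpha):=\alpha z-\alpha^\perp\in{}^*\mathbb K_\varepsilon$. For $\mu,\nu,\iota\in\mathbb P\mathbb K_{{\rm N}(\varepsilon)}$, $${}^*\mathcal O^\mu_\nu(z):=\{\alpha\in{}^*\mathcal O(z):\langle\alpha\rangle\cdot\mu\in\mathbb P\mathbb K_\varepsilon,\ \langle\varepsilon(\alpha)\rangle\le\nu\},\qquad {}^*\mathcal O^{\mu[\iota]}_\nu(z):=\{\alpha\in{}^*\mathcal O^\mu_\nu(z):\langle\alpha\rangle\cdot\mu<\iota\}.$$ ${\rm Gal}(K/\mathbb Q)$ acts on ${}^*\mathbb K$ and on $\mathbb P\mathbb K$ by permuting coordinates: $\sigma(z)=(z_{\sigma\cdot\tau})_\tau$, $\sigma(\mu)=(\mu_{\sigma\cdot\tau})_\tau$, where $\sigma\cdot\tau:=\tau\circ\sigma^{-1}$; this maps ${}^*\mathcal O$ to itself. $z$ is $(\mu,\nu)$-composable with $w$ if ${}^*\mathcal O^\mu_\nu(z)\ne0$ and ${}^*\mathcal O^\nu_\mu(w)\neq0$. In this case: if $\mu>\nu$, $z$ is called an $\mathcal O$-fast divisor and $w$ an $\mathcal O$-slow divisor of $zw$; if $\mu=\nu$, both are $\mathcal O$-flat divisors; if $\mu,\nu$ are not related by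 the order, both are $\mathcal O$-oscillatory divisors. *)

theory Defs
  imports Complex_Main "HOL-Library.FuncSet" "HOL-Computational_Algebra.Polynomial"
    "HOL-Algebra.FiniteProduct"
begin

definition nonprincipal_ultrafilter :: "nat filter \<Rightarrow> bool" where
  "nonprincipal_ultrafilter U \<longleftrightarrow>
     U \<noteq> bot \<and>
     (\<forall>P. eventually P U \<or> eventually (\<lambda>n. \<not> P n) U) \<and>
     (\<forall>m. \<not> eventually (\<lambda>n. n = m) U)"

type_synonym 'a ultra = "(nat \<Rightarrow> 'a) set"

definition ueq :: "nat filter \<Rightarrow> ((nat \<Rightarrow> 'a) \<times> (nat \<Rightarrow> 'a)) set" where
  "ueq U = {(f, g). \<forall>\<^sub>F n in U. f n = g n}"

definition uclass :: "nat filter \<Rightarrow> (nat \<Rightarrow> 'a) \<Rightarrow> 'a ultra" where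
  "uclass U f = ueq U `` {f}"

text \<open>A class consists of all sequences in the ambient type that agree almost everywhere, so
  that \<^term>\<open>A \<subseteq> B\<close> gives an honest inclusion of the ultrapowers of \<^term>\<open>A\<close> and \<^term>\<open>B\<close>.\<close>

definition ultrapower :: "nat filter \<Rightarrow> 'a set \<Rightarrow> 'a ultra set" where
  "ultrapower U A = {f. range f \<subseteq> A} // ueq U"

definition ustd :: "nat filter \<Rightarrow> 'a \<Rightarrow> 'a ultra" where
  "ustd U a = uclass U (\<lambda>_. a)"

definition umap :: "nat filter \<Rightarrow> ('a \<Rightarrow> 'b) \<Rightarrow> 'a ultra \<Rightarrow> 'b ultra" where
  "umap U h X = {k. \<exists>f\<in>X. \<forall>\<^sub>F n in U. k n = h (f n)}"

definition umap2 :: "nat filter \<Rightarrow> ('a \<Rightarrow> 'b \<Rightarrow> 'c) \<Rightarrow> 'a ultra \<Rightarrow> 'b ultra \<Rightarrow> 'c ultra" where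
  "umap2 U h X Y = {k. \<exists>f\<in>X. \<exists>g\<in>Y. \<forall>\<^sub>F n in U. k n = h (f n) (g n)}"

definition urel :: "nat filter \<Rightarrow> ('a \<Rightarrow> 'b \<Rightarrow> bool) \<Rightarrow> 'a ultra \<Rightarrow> 'b ultra \<Rightarrow> bool" where
  "urel U R X Y \<longleftrightarrow> (\<exists>f\<in>X. \<exists>g\<in>Y. \<forall>\<^sub>F n in U. R (f n) (g n))"

lemma mem_uclass: "g \<in> uclass U f \<longleftrightarrow> (\<forall>\<^sub>F n in U. f n = g n)"
  by (simp add: uclass_def ueq_def)

lemma uclass_eq_iff: "uclass U f = uclass U g \<longleftrightarrow> (\<forall>\<^sub>F n in U. f n = g n)"
proof
  assume "uclass U f = uclass U g"
  then have "g \<in> uclass U f" by (simp add: mem_uclass)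
  then show "\<forall>\<^sub>F n in U. f n = g n" by (simp add: mem_uclass)
next
  assume *: "\<forall>\<^sub>F n in U. f n = g n"
  show "uclass U f = uclass U g"
    unfolding set_eq_iff mem_uclass
  proof (intro allI iffI)
    fix h assume "\<forall>\<^sub>F n in U. f n = h n"
    with * show "\<forall>\<^sub>F n in U. g n = h n" by eventually_elim simp
  next
    fix h assume "\<forall>\<^sub>F n in U. g n = h n"
    with * show "\<forall>\<^sub>F n in U. f n = h n" by eventually_elim simp
  qed
qed

lemma umap_uclass: "umap U h (uclass U f) = uclass U (\<lambda>n. h (f n))"
  unfolding set_eq_iff umap_def mem_Collect_eq
proof (intro allI iffI)
  fix k assume "\<exists>f'\<in>uclass U f. \<forall>\<^sub>F n in U. k n = h (f' n)"
  then obtain f' where "\<forall>\<^sub>F n in U. f n = f' n" "\<forall>\<^sub>F n in U. k n = h (f' n)"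
    by (auto simp: mem_uclass)
  then show "k \<in> uclass U (\<lambda>n. h (f n))"
    unfolding mem_uclass by eventually_elim simp
next
  fix k assume "k \<in> uclass U (\<lambda>n. h (f n))"
  then have "\<forall>\<^sub>F n in U. k n = h (f n)"
    unfolding mem_uclass by eventually_elim simp
  then show "\<exists>f'\<in>uclass U f. \<forall>\<^sub>F n in U. k n = h (f' n)"
    by (intro bexI[of _ f]) (simp_all add: mem_uclass)
qed

lemma umap2_uclass: "umap2 U h (uclass U f) (uclass U g) = uclass U (\<lambda>n. h (f n) (g n))"
  unfolding set_eq_iff umap2_def mem_Collect_eq
proof (intro allI iffI)
  fix k assume "\<exists>f'\<in>uclass U f. \<exists>g'\<in>uclass U g. \<forall>\<^sub>F n in U. k n = h (f' n) (g' n)"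
  then obtain f' g' where "\<forall>\<^sub>F n in U. f n = f' n" "\<forall>\<^sub>F n in U. g n = g' n"
      "\<forall>\<^sub>F n in U. k n = h (f' n) (g' n)"
    by (auto simp: mem_uclass)
  then show "k \<in> uclass U (\<lambda>n. h (f n) (g n))"
    unfolding mem_uclass by eventually_elim simp
next
  fix k assume "k \<in> uclass U (\<lambda>n. h (f n) (g n))"
  then have "\<forall>\<^sub>F n in U. k n = h (f n) (g n)"
    unfolding mem_uclass by eventually_elim simp
  then show "\<exists>f'\<in>uclass U f. \<exists>g'\<in>uclass U g. \<forall>\<^sub>F n in U. k n = h (f' n) (g' n)"
    by (intro bexI[of _ f] bexI[of _ g]) (simp_all add: mem_uclass)
qed

lemma urel_uclass: "urel U R (uclass U f) (uclass U g) \<longleftrightarrow> (\<forall>\<^sub>F n in U. R (f n) (g n))"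
proof
  assume "urel U R (uclass U f) (uclass U g)"
  then obtain f' g' where "\<forall>\<^sub>F n in U. f n = f' n" "\<forall>\<^sub>F n in U. g n = g' n"
      "\<forall>\<^sub>F n in U. R (f' n) (g' n)"
    by (auto simp: mem_uclass urel_def)
  then show "\<forall>\<^sub>F n in U. R (f n) (g n)" by eventually_elim simp
next
  assume "\<forall>\<^sub>F n in U. R (f n) (g n)"
  then show "urel U R (uclass U f) (uclass U g)"
    unfolding urel_def by (intro bexI[of _ f] bexI[of _ g]) (simp_all add: mem_uclass)
qed

lemma ultrapower_eq: "ultrapower U A = uclass U ` {f. range f \<subseteq> A}"
  by (auto simp: ultrapower_def uclass_def quotient_def)

definition infinitesimal :: "nat filter \<Rightarrow> 'a::real_normed_vector ultra \<Rightarrow> bool" where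
  "infinitesimal U x \<longleftrightarrow> (\<forall>r>0. urel U (<) (umap U norm x) (ustd U r))"

definition star_reals_fin :: "nat filter \<Rightarrow> real ultra set" where
  "star_reals_fin U =
     {x \<in> ultrapower U UNIV. \<exists>r. urel U (\<le>) (umap U norm x) (ustd U r)}"

definition star_reals_fin_units_pos :: "nat filter \<Rightarrow> real ultra set" where
  "star_reals_fin_units_pos U =
     {x \<in> star_reals_fin U. urel U (<) (ustd U 0) x \<and> \<not> infinitesimal U x}"

type_synonym growth = "real ultra set"

definition star_reals_nonneg :: "nat filter \<Rightarrow> real ultra set" where
  "star_reals_nonneg U = {x \<in> ultrapower U UNIV. urel U (<) (ustd U 0) x} \<union> {ustd U 0}"

definition growth_class :: "nat filter \<Rightarrow> real ultra \<Rightarrow> growth" where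
  "growth_class U x = umap2 U (*) x ` star_reals_fin_units_pos U"

definition PP :: "nat filter \<Rightarrow> growth set" where
  "PP U = growth_class U ` star_reals_nonneg U"

text \<open>Product of classes as elementwise product of orbits; the order is induced from
  representatives.\<close>

definition growth_mult :: "nat filter \<Rightarrow> growth \<Rightarrow> growth \<Rightarrow> growth" where
  "growth_mult U A B = {umap2 U (*) x y | x y. x \<in> A \<and> y \<in> B}"

definition growth_le :: "nat filter \<Rightarrow> growth \<Rightarrow> growth \<Rightarrow> bool" where
  "growth_le U A B \<longleftrightarrow> (\<exists>x\<in>A. \<exists>y\<in>B. urel U (\<le>) x y)"

definition growth_less :: "nat filter \<Rightarrow> growth \<Rightarrow> growth \<Rightarrow> bool" where
  "growth_less U A B \<longleftrightarrow> growth_le U A B \<and> A \<noteq> B"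

definition PP_monoid :: "nat filter \<Rightarrow> growth monoid" where
  "PP_monoid U =
     \<lparr>carrier = PP U, mult = growth_mult U, one = growth_class U (ustd U 1)\<rparr>"

lemma star_reals_fin_units_pos_eq:
  assumes "nonprincipal_ultrafilter U"
  shows "star_reals_fin_units_pos U =
    {uclass U f | f. \<exists>a>0. \<exists>b. \<forall>\<^sub>F n in U. a \<le> f n \<and> f n \<le> b}" (is "_ = ?R")
proof (intro Set.set_eqI iffI)
  fix x assume x: "x \<in> star_reals_fin_units_pos U"
  then obtain f where f: "x = uclass U f"
    by (auto simp: star_reals_fin_units_pos_def star_reals_fin_def ultrapower_eq)
  from x obtain b where b: "\<forall>\<^sub>F n in U. \<bar>f n\<bar> \<le> b"
    by (auto simp: star_reals_fin_units_pos_def star_reals_fin_def f ustd_def umap_uclass urel_uclass)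
  from x have p: "\<forall>\<^sub>F n in U. 0 < f n"
    by (auto simp: star_reals_fin_units_pos_def f ustd_def urel_uclass)
  from x obtain a where a: "a > 0" "\<not> (\<forall>\<^sub>F n in U. \<bar>f n\<bar> < a)"
    by (auto simp: star_reals_fin_units_pos_def infinitesimal_def f ustd_def umap_uclass urel_uclass)
  with assms have "\<forall>\<^sub>F n in U. \<not> \<bar>f n\<bar> < a"
    unfolding nonprincipal_ultrafilter_def by metis
  with b p have "\<forall>\<^sub>F n in U. a \<le> f n \<and> f n \<le> b" by eventually_elim auto
  with f a show "x \<in> ?R" by blast
next
  fix x assume "x \<in> ?R"
  then obtain f a b where f: "x = uclass U f" and a: "a > 0"
    and ab: "\<forall>\<^sub>F n in U. a \<le> f n \<and> f n \<le> b" by blast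
  have "\<forall>\<^sub>F n in U. \<bar>f n\<bar> \<le> b" using ab by eventually_elim (use a in auto)
  moreover have "\<forall>\<^sub>F n in U. 0 < f n" using ab by eventually_elim (use a in auto)
  moreover have "\<not> (\<forall>\<^sub>F n in U. \<bar>f n\<bar> < a)"
  proof
    assume "\<forall>\<^sub>F n in U. \<bar>f n\<bar> < a"
    with ab have "\<forall>\<^sub>F n in U. False" by eventually_elim auto
    then show False using assms by (auto simp: nonprincipal_ultrafilter_def trivial_limit_def)
  qed
  ultimately show "x \<in> star_reals_fin_units_pos U"
    using a by (auto simp: star_reals_fin_units_pos_def star_reals_fin_def infinitesimal_def
        f ustd_def umap_uclass urel_uclass ultrapower_eq)
qed

lemma growth_mult_class:
  assumes U: "nonprincipal_ultrafilter U"
    and xy: "x \<in> star_reals_nonneg U" "y \<in> star_reals_nonneg U"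
  shows "growth_mult U (growth_class U x) (growth_class U y) = growth_class U (umap2 U (*) x y)"
proof -
  obtain f g where fg: "x = uclass U f" "y = uclass U g"
    using xy by (auto simp: star_reals_nonneg_def ultrapower_eq ustd_def)
  show ?thesis
  proof (intro Set.set_eqI iffI)
    fix t assume "t \<in> growth_mult U (growth_class U x) (growth_class U y)"
    then obtain u v where uv: "u \<in> star_reals_fin_units_pos U" "v \<in> star_reals_fin_units_pos U"
      and t: "t = umap2 U (*) (umap2 U (*) x u) (umap2 U (*) y v)"
      by (auto simp: growth_mult_def growth_class_def)
    from uv obtain h a b k c d where
      h: "u = uclass U h" "a > 0" "\<forall>\<^sub>F n in U. a \<le> h n \<and> h n \<le> b" and
      k: "v = uclass U k" "c > 0" "\<forall>\<^sub>F n in U. c \<le> k n \<and> k n \<le> d"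
      by (auto simp: star_reals_fin_units_pos_eq[OF U])
    have "\<forall>\<^sub>F n in U. a * c \<le> h n * k n \<and> h n * k n \<le> b * d"
      using h(3) k(3) by eventually_elim (use h(2) k(2) in \<open>auto intro!: mult_mono\<close>)
    moreover have "a * c > 0" using h(2) k(2) by simp
    ultimately have "uclass U (\<lambda>n. h n * k n) \<in> star_reals_fin_units_pos U"
      unfolding star_reals_fin_units_pos_eq[OF U]
      by (intro CollectI exI[of _ "\<lambda>n. h n * k n"] conjI exI[of _ "a * c"] exI[of _ "b * d"]) simp_all
    moreover have "t = umap2 U (*) (umap2 U (*) x y) (uclass U (\<lambda>n. h n * k n))"
      by (simp add: t fg h(1) k(1) umap2_uclass ac_simps)
    ultimately show "t \<in> growth_class U (umap2 U (*) x y)"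
      by (auto simp: growth_class_def)
  next
    fix t assume "t \<in> growth_class U (umap2 U (*) x y)"
    then obtain h where h: "uclass U h \<in> star_reals_fin_units_pos U"
      "t = umap2 U (*) (umap2 U (*) x y) (uclass U h)"
      by (auto simp: growth_class_def star_reals_fin_units_pos_eq[OF U])
    have one: "uclass U (\<lambda>_. 1) \<in> star_reals_fin_units_pos U"
      unfolding star_reals_fin_units_pos_eq[OF U]
      by (intro CollectI exI[of _ "\<lambda>_. 1"] conjI exI[of _ 1]) auto
    have "t = umap2 U (*) (umap2 U (*) x (uclass U h)) (umap2 U (*) y (uclass U (\<lambda>_. 1)))"
      by (simp add: h(2) fg umap2_uclass ac_simps)
    with h(1) one show "t \<in> growth_mult U (growth_class U x) (growth_class U y)"
      unfolding growth_mult_def growth_class_def by blast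
  qed
qed

lemma comm_monoid_PP:
  assumes U: "nonprincipal_ultrafilter U"
  shows "comm_monoid (PP_monoid U)"
proof -
  have nn: "x \<in> star_reals_nonneg U \<longleftrightarrow>
      (\<exists>f. x = uclass U f \<and> ((\<forall>\<^sub>F n in U. 0 < f n) \<or> (\<forall>\<^sub>F n in U. 0 = f n)))" for x
  proof -
    have "(\<exists>f. x = uclass U f \<and> (\<forall>\<^sub>F n in U. 0 = f n)) \<longleftrightarrow> x = uclass U (\<lambda>_. 0)"
    proof (intro iffI)
      assume "\<exists>f. x = uclass U f \<and> (\<forall>\<^sub>F n in U. 0 = f n)"
      then obtain f where "x = uclass U f" "\<forall>\<^sub>F n in U. 0 = f n" by (elim exE conjE)
      then show "x = uclass U (\<lambda>_. 0)"
        using uclass_eq_iff[of U "\<lambda>_. 0" f] by simp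
    next
      assume "x = uclass U (\<lambda>_. 0)"
      then show "\<exists>f. x = uclass U f \<and> (\<forall>\<^sub>F n in U. 0 = f n)"
        by (intro exI[of _ "\<lambda>_. 0"]) simp
    qed
    moreover have "x \<in> star_reals_nonneg U \<longleftrightarrow>
        (\<exists>f. x = uclass U f \<and> (\<forall>\<^sub>F n in U. 0 < f n)) \<or> x = uclass U (\<lambda>_. 0)"
      by (auto simp: star_reals_nonneg_def ultrapower_eq ustd_def urel_uclass)
    ultimately show ?thesis by blast
  qed
  have cl: "umap2 U (*) x y \<in> star_reals_nonneg U"
    if xy: "x \<in> star_reals_nonneg U" "y \<in> star_reals_nonneg U" for x y
  proof -
    obtain f g where f: "x = uclass U f" "(\<forall>\<^sub>F n in U. 0 < f n) \<or> (\<forall>\<^sub>F n in U. 0 = f n)"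
      and g: "y = uclass U g" "(\<forall>\<^sub>F n in U. 0 < g n) \<or> (\<forall>\<^sub>F n in U. 0 = g n)"
      using xy[unfolded nn] by (elim exE conjE) (rule that)
    have "(\<forall>\<^sub>F n in U. 0 < f n * g n) \<or> (\<forall>\<^sub>F n in U. 0 = f n * g n)"
      using f(2)
    proof
      assume f0: "\<forall>\<^sub>F n in U. 0 < f n"
      from g(2) show ?thesis
      proof
        assume "\<forall>\<^sub>F n in U. 0 < g n"
        with f0 have "\<forall>\<^sub>F n in U. 0 < f n * g n" by eventually_elim simp
        then show ?thesis ..
      next
        assume "\<forall>\<^sub>F n in U. 0 = g n"
        then have "\<forall>\<^sub>F n in U. 0 = f n * g n" by eventually_elim simp
        then show ?thesis ..
      qed
    next
      assume "\<forall>\<^sub>F n in U. 0 = f n"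
      then have "\<forall>\<^sub>F n in U. 0 = f n * g n" by eventually_elim simp
      then show ?thesis ..
    qed
    then show ?thesis unfolding nn f(1) g(1) umap2_uclass
      by (intro exI[of _ "\<lambda>n. f n * g n"] conjI refl)
  qed
  have one: "ustd U 1 \<in> star_reals_nonneg U"
    unfolding nn ustd_def by (intro exI[of _ "\<lambda>_. 1"]) auto
  note m = growth_mult_class[OF U]
  have rep: "\<exists>f. x = uclass U f" if "x \<in> star_reals_nonneg U" for x
    using that unfolding nn by (elim exE conjE) (rule exI)
  have assoc: "umap2 U (*) (umap2 U (*) x y) z = umap2 U (*) x (umap2 U (*) y z)"
    if "x \<in> star_reals_nonneg U" "y \<in> star_reals_nonneg U" "z \<in> star_reals_nonneg U" for x y z
    using that[THEN rep] by (auto simp: umap2_uclass ac_simps)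
  have comm: "umap2 U (*) x y = umap2 U (*) y x"
    if "x \<in> star_reals_nonneg U" "y \<in> star_reals_nonneg U" for x y
    using that[THEN rep] by (auto simp: umap2_uclass ac_simps)
  have unit: "umap2 U (*) (ustd U 1) x = x" if "x \<in> star_reals_nonneg U" for x
    using that[THEN rep] by (auto simp: umap2_uclass ustd_def)
  show ?thesis
  proof (rule comm_monoidI)
    fix A B assume "A \<in> carrier (PP_monoid U)" "B \<in> carrier (PP_monoid U)"
    then show "A \<otimes>\<^bsub>PP_monoid U\<^esub> B \<in> carrier (PP_monoid U)"
      by (auto simp: PP_monoid_def PP_def m cl)
  next
    show "\<one>\<^bsub>PP_monoid U\<^esub> \<in> carrier (PP_monoid U)"
      by (auto simp: PP_monoid_def PP_def one)
  next
    fix A B C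
    assume "A \<in> carrier (PP_monoid U)" "B \<in> carrier (PP_monoid U)" "C \<in> carrier (PP_monoid U)"
    then show "A \<otimes>\<^bsub>PP_monoid U\<^esub> B \<otimes>\<^bsub>PP_monoid U\<^esub> C = A \<otimes>\<^bsub>PP_monoid U\<^esub> (B \<otimes>\<^bsub>PP_monoid U\<^esub> C)"
      by (auto simp: PP_monoid_def PP_def m cl assoc)
  next
    fix A assume "A \<in> carrier (PP_monoid U)"
    then show "\<one>\<^bsub>PP_monoid U\<^esub> \<otimes>\<^bsub>PP_monoid U\<^esub> A = A"
      by (auto simp: PP_monoid_def PP_def m one unit)
  next
    fix A B assume "A \<in> carrier (PP_monoid U)" "B \<in> carrier (PP_monoid U)"
    then show "A \<otimes>\<^bsub>PP_monoid U\<^esub> B = B \<otimes>\<^bsub>PP_monoid U\<^esub> A"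
      by (auto simp: PP_monoid_def PP_def m comm)
  qed
qed

definition growth_of :: "nat filter \<Rightarrow> complex ultra \<Rightarrow> growth" where
  "growth_of U x = growth_class U (umap U cmod x)"

definition field_hom_on_UNIV :: "('a::field \<Rightarrow> 'b::field) \<Rightarrow> bool" where
  "field_hom_on_UNIV f \<longleftrightarrow>
     f 1 = 1 \<and> (\<forall>x y. f (x + y) = f x + f y) \<and> (\<forall>x y. f (x * y) = f x * f y)"

definition Gal :: "('k::field_char_0 \<Rightarrow> 'k) set" where
  "Gal = {\<sigma>. bij \<sigma> \<and> field_hom_on_UNIV \<sigma> \<and> (\<forall>q::rat. \<sigma> (of_rat q) = of_rat q)}"

text \<open>The field is the whole type; it contains the rationals via \<^const>\<open>of_rat\<close>. Galois means
  that the field fixed by all automorphisms is the base field.\<close>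

definition finite_galois_over_rat :: "'k::field_char_0 itself \<Rightarrow> bool" where
  "finite_galois_over_rat (_ :: 'k itself) \<longleftrightarrow>
     (\<exists>B::'k set. finite B \<and> module.span (\<lambda>(q::rat) x. of_rat q * x) B = UNIV) \<and>
     {x::'k. \<forall>\<sigma>\<in>Gal. \<sigma> x = x} = range of_rat"

definition Emb :: "('k::field_char_0 \<Rightarrow> complex) set" where
  "Emb = {\<tau>. field_hom_on_UNIV \<tau>}"

definition ring_of_integers :: "'k::field_char_0 set" where
  "ring_of_integers = {\<alpha>. algebraic_int \<alpha>}"

type_synonym ('k, 'v) tuple = "('k \<Rightarrow> complex) \<Rightarrow> 'v"

definition Mink :: "('k::field_char_0, complex) tuple set" where
  "Mink = {z \<in> Emb \<rightarrow>\<^sub>E UNIV. \<forall>\<tau>\<in>Emb. cnj (z \<tau>) = z (cnj \<circ> \<tau>)}"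

definition mink_mult ::
  "('k::field_char_0, complex) tuple \<Rightarrow> ('k, complex) tuple \<Rightarrow> ('k, complex) tuple" where
  "mink_mult z w = (\<lambda>\<tau>\<in>Emb. z \<tau> * w \<tau>)"

definition mink_diff ::
  "('k::field_char_0, complex) tuple \<Rightarrow> ('k, complex) tuple \<Rightarrow> ('k, complex) tuple" where
  "mink_diff z w = (\<lambda>\<tau>\<in>Emb. z \<tau> - w \<tau>)"

definition mink_embed :: "'k::field_char_0 \<Rightarrow> ('k, complex) tuple" where
  "mink_embed \<alpha> = (\<lambda>\<tau>\<in>Emb. \<tau> \<alpha>)"

definition star_Mink :: "nat filter \<Rightarrow> ('k::field_char_0, complex) tuple ultra set" where
  "star_Mink U = ultrapower U Mink"

definition star_O :: "nat filter \<Rightarrow> ('k::field_char_0, complex) tuple ultra set" where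
  "star_O U = ultrapower U (mink_embed ` ring_of_integers)"

definition coord ::
  "nat filter \<Rightarrow> ('k \<Rightarrow> complex) \<Rightarrow> ('k::field_char_0, complex) tuple ultra \<Rightarrow> complex ultra" where
  "coord U \<tau> Z = umap U (\<lambda>z. z \<tau>) Z"

definition star_Mink_eps :: "nat filter \<Rightarrow> ('k::field_char_0, complex) tuple ultra set" where
  "star_Mink_eps U = {Z \<in> star_Mink U. \<forall>\<tau>\<in>Emb. infinitesimal U (coord U \<tau> Z)}"

definition PK :: "nat filter \<Rightarrow> ('k::field_char_0, growth) tuple set" where
  "PK U = {\<mu> \<in> Emb \<rightarrow>\<^sub>E PP U. \<forall>\<tau>\<in>Emb. \<mu> \<tau> = \<mu> (cnj \<circ> \<tau>)}"

definition PK_mult :: "nat filter \<Rightarrow> ('k::field_char_0, growth) tuple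
    \<Rightarrow> ('k, growth) tuple \<Rightarrow> ('k, growth) tuple" where
  "PK_mult U \<mu> \<mu>' = (\<lambda>\<tau>\<in>Emb. growth_mult U (\<mu> \<tau>) (\<mu>' \<tau>))"

definition PK_le :: "nat filter \<Rightarrow> ('k::field_char_0, growth) tuple
    \<Rightarrow> ('k, growth) tuple \<Rightarrow> bool" where
  "PK_le U \<mu> \<mu>' \<longleftrightarrow> (\<forall>\<tau>\<in>Emb. growth_le U (\<mu> \<tau>) (\<mu>' \<tau>))"

definition PK_less :: "nat filter \<Rightarrow> ('k::field_char_0, growth) tuple
    \<Rightarrow> ('k, growth) tuple \<Rightarrow> bool" where
  "PK_less U \<mu> \<mu>' \<longleftrightarrow> (\<forall>\<tau>\<in>Emb. growth_less U (\<mu> \<tau>) (\<mu>' \<tau>))"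

definition PK_of :: "nat filter \<Rightarrow> ('k::field_char_0, complex) tuple ultra
    \<Rightarrow> ('k, growth) tuple" where
  "PK_of U Z = (\<lambda>\<tau>\<in>Emb. growth_of U (coord U \<tau> Z))"

definition PK_eps :: "nat filter \<Rightarrow> ('k::field_char_0, growth) tuple set" where
  "PK_eps U = PK_of U ` star_Mink_eps U"

definition PK_Neps :: "nat filter \<Rightarrow> ('k::field_char_0, growth) tuple set" where
  "PK_Neps U = {\<mu> \<in> PK U. \<exists>x\<in>star_reals_nonneg U. infinitesimal U x \<and>
     finprod (PP_monoid U) \<mu> Emb = growth_class U x}"

definition is_perp :: "nat filter \<Rightarrow> ('k::field_char_0, complex) tuple
    \<Rightarrow> ('k, complex) tuple ultra \<Rightarrow> ('k, complex) tuple ultra \<Rightarrow> bool" where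
  "is_perp U z \<alpha> \<beta> \<longleftrightarrow> \<beta> \<in> star_O U \<and>
     umap2 U mink_diff (umap2 U mink_mult \<alpha> (ustd U z)) \<beta> \<in> star_Mink_eps U"

definition dioph :: "nat filter \<Rightarrow> ('k::field_char_0, complex) tuple
    \<Rightarrow> ('k, complex) tuple ultra set" where
  "dioph U z = {\<alpha> \<in> star_O U. \<exists>\<beta>. is_perp U z \<alpha> \<beta>}"

definition perp :: "nat filter \<Rightarrow> ('k::field_char_0, complex) tuple
    \<Rightarrow> ('k, complex) tuple ultra \<Rightarrow> ('k, complex) tuple ultra" where
  "perp U z \<alpha> = (THE \<beta>. is_perp U z \<alpha> \<beta>)"

definition eps :: "nat filter \<Rightarrow> ('k::field_char_0, complex) tuple
    \<Rightarrow> ('k, complex) tuple ultra \<Rightarrow> ('k, complex) tuple ultra" where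
  "eps U z \<alpha> = umap2 U mink_diff (umap2 U mink_mult \<alpha> (ustd U z)) (perp U z \<alpha>)"

definition dioph_gd :: "nat filter \<Rightarrow> ('k::field_char_0, growth) tuple
    \<Rightarrow> ('k, growth) tuple \<Rightarrow> ('k, complex) tuple \<Rightarrow> ('k, complex) tuple ultra set" where
  "dioph_gd U \<mu> \<nu> z = {\<alpha> \<in> dioph U z.
     PK_mult U (PK_of U \<alpha>) \<mu> \<in> PK_eps U \<and> PK_le U (PK_of U (eps U z \<alpha>)) \<nu>}"

definition dioph_gd_fine :: "nat filter \<Rightarrow> ('k::field_char_0, growth) tuple
    \<Rightarrow> ('k, growth) tuple \<Rightarrow> ('k, growth) tuple \<Rightarrow> ('k, complex) tuple
    \<Rightarrow> ('k, complex) tuple ultra set" where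
  "dioph_gd_fine U \<mu> \<iota> \<nu> z =
     {\<alpha> \<in> dioph_gd U \<mu> \<nu> z. PK_less U (PK_mult U (PK_of U \<alpha>) \<mu>) \<iota>}"

text \<open>One definition serves both Minkowski space and growth tuples;
  \<^term>\<open>inv_into UNIV \<sigma>\<close> is the inverse automorphism.\<close>

definition gal_act :: "('k::field_char_0 \<Rightarrow> 'k) \<Rightarrow> ('k, 'v) tuple \<Rightarrow> ('k, 'v) tuple" where
  "gal_act \<sigma> z = (\<lambda>\<tau>\<in>Emb. z (\<tau> \<circ> inv_into UNIV \<sigma>))"

definition star_gal_act :: "nat filter \<Rightarrow> ('k::field_char_0 \<Rightarrow> 'k)
    \<Rightarrow> ('k, 'v) tuple ultra \<Rightarrow> ('k, 'v) tuple ultra" where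
  "star_gal_act U \<sigma> = umap U (gal_act \<sigma>)"

definition composable :: "nat filter \<Rightarrow> ('k::field_char_0, growth) tuple
    \<Rightarrow> ('k, growth) tuple \<Rightarrow> ('k, complex) tuple \<Rightarrow> ('k, complex) tuple \<Rightarrow> bool" where
  "composable U \<mu> \<nu> z w \<longleftrightarrow>
     z \<in> Mink \<and> w \<in> Mink \<and> \<mu> \<in> PK_Neps U \<and> \<nu> \<in> PK_Neps U \<and>
     dioph_gd U \<mu> \<nu> z \<noteq> {ustd U (mink_embed 0)} \<and>
     dioph_gd U \<nu> \<mu> w \<noteq> {ustd U (mink_embed 0)}"

text \<open>In the following four predicates the status is that of \<^term>\<open>z\<close> in the product of
  \<^term>\<open>z\<close> and \<^term>\<open>w\<close>, witnessed by \<^term>\<open>\<mu>\<close> and \<^term>\<open>\<nu>\<close>. A slow divisor is the second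
  partner of a composable pair, hence the swapped arguments. The flat and oscillatory
  conditions are symmetric under exchanging the two factors together with the two growth
  tuples, so they also cover the second partner.\<close>

definition fast_divisor_at :: "nat filter \<Rightarrow> ('k::field_char_0, growth) tuple
    \<Rightarrow> ('k, growth) tuple \<Rightarrow> ('k, complex) tuple \<Rightarrow> ('k, complex) tuple \<Rightarrow> bool" where
  "fast_divisor_at U \<mu> \<nu> z w \<longleftrightarrow> composable U \<mu> \<nu> z w \<and> PK_less U \<nu> \<mu>"

definition slow_divisor_at :: "nat filter \<Rightarrow> ('k::field_char_0, growth) tuple
    \<Rightarrow> ('k, growth) tuple \<Rightarrow> ('k, complex) tuple \<Rightarrow> ('k, complex) tuple \<Rightarrow> bool" where
  "slow_divisor_at U \<mu> \<nu> z w \<longleftrightarrow> composable U \<mu> \<nu> w z \<and> PK_less U \<nu> \<mu>"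

definition flat_divisor_at :: "nat filter \<Rightarrow> ('k::field_char_0, growth) tuple
    \<Rightarrow> ('k, growth) tuple \<Rightarrow> ('k, complex) tuple \<Rightarrow> ('k, complex) tuple \<Rightarrow> bool" where
  "flat_divisor_at U \<mu> \<nu> z w \<longleftrightarrow> composable U \<mu> \<nu> z w \<and> \<mu> = \<nu>"

definition oscillatory_divisor_at :: "nat filter \<Rightarrow> ('k::field_char_0, growth) tuple
    \<Rightarrow> ('k, growth) tuple \<Rightarrow> ('k, complex) tuple \<Rightarrow> ('k, complex) tuple \<Rightarrow> bool" where
  "oscillatory_divisor_at U \<mu> \<nu> z w \<longleftrightarrow>
     composable U \<mu> \<nu> z w \<and> \<not> PK_le U \<mu> \<nu> \<and> \<not> PK_le U \<nu> \<mu>"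

definition fast_divisor ::
  "nat filter \<Rightarrow> ('k::field_char_0, complex) tuple \<Rightarrow> ('k, complex) tuple \<Rightarrow> bool" where
  "fast_divisor U z x \<longleftrightarrow> (\<exists>\<mu> \<nu> w. x = mink_mult z w \<and> fast_divisor_at U \<mu> \<nu> z w)"

definition slow_divisor ::
  "nat filter \<Rightarrow> ('k::field_char_0, complex) tuple \<Rightarrow> ('k, complex) tuple \<Rightarrow> bool" where
  "slow_divisor U z x \<longleftrightarrow> (\<exists>\<mu> \<nu> w. x = mink_mult z w \<and> slow_divisor_at U \<mu> \<nu> z w)"

definition flat_divisor ::
  "nat filter \<Rightarrow> ('k::field_char_0, complex) tuple \<Rightarrow> ('k, complex) tuple \<Rightarrow> bool" where
  "flat_divisor U z x \<longleftrightarrow> (\<exists>\<mu> \<nu> w. x = mink_mult z w \<and> flat_divisor_at U \<mu> \<nu> z w)"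

definition oscillatory_divisor ::
  "nat filter \<Rightarrow> ('k::field_char_0, complex) tuple \<Rightarrow> ('k, complex) tuple \<Rightarrow> bool" where
  "oscillatory_divisor U z x \<longleftrightarrow>
     (\<exists>\<mu> \<nu> w. x = mink_mult z w \<and> oscillatory_divisor_at U \<mu> \<nu> z w)"

end

theory Submission
  imports "Jordan_Normal_Form.Char_Poly" Defs
begin

text \<open>Every ingredient of the definitions is natural under the permutation of coordinates induced
  by \<open>\<sigma>\<close>, so each inclusion holds for \<open>\<sigma>\<close> and its reverse follows by applying it to the inverse
  of \<open>\<sigma>\<close>. The one point that is not formal is the definite description in \<^const>\<open>perp\<close>, which is
  natural only because the element it describes is unique. Two candidates differ by a
  sequence of algebraic integers almost all of which have absolute value less than 1 under each of
  the finitely many embeddings; the product of the Galois conjugates of such an integer is a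
  rational integer of absolute value less than 1, so it vanishes.\<close>

section \<open>Algebraic integers in a Galois extension\<close>

text \<open>Letting scalars act through \<open>h\<close> allows one argument to serve both integer
  coefficients (algebraic integers) and rational ones (algebraic numbers).\<close>

lemma module_hom_scale:
  fixes h :: "'r::comm_ring_1 \<Rightarrow> 'k::field"
  assumes "comm_ring_hom h"
  shows "Modules.module (\<lambda>r x. h r * x)"
proof -
  interpret comm_ring_hom h by fact
  show ?thesis by unfold_locales (simp_all add: hom_add hom_mult algebra_simps)
qed

text \<open>Cayley--Hamilton: \<open>x\<close> is an eigenvalue of the matrix of multiplication by \<open>x\<close> on the
  module spanned by \<open>V\<close>, the elements of \<open>V\<close> being the entries of an eigenvector.\<close>

lemma monic_root_if_mult_span:
  fixes h :: "'r::comm_ring_1 \<Rightarrow> 'k::field"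
  assumes h: "comm_ring_hom h" and V: "finite V" "\<exists>v\<in>V. v \<noteq> 0"
    and x: "\<And>v. v \<in> V \<Longrightarrow> x * v \<in> Modules.module.span (\<lambda>r x. h r * x) V"
  shows "\<exists>p. lead_coeff p = 1 \<and> poly (map_poly h p) x = 0"
proof -
  interpret comm_ring_hom h by fact
  interpret m: Modules.module "\<lambda>r x. h r * x" using h by (rule module_hom_scale)
  have "\<exists>c. x * v = (\<Sum>w\<in>V. h (c w) * w)" if "v \<in> V" for v
    using x[OF that] m.span_finite[OF V(1)] by auto
  then obtain c where c: "\<And>v. v \<in> V \<Longrightarrow> x * v = (\<Sum>w\<in>V. h (c v w) * w)" by metis
  define n where "n = card V"
  obtain e where e: "bij_betw e {0..<n} V"
    using ex_bij_betw_nat_finite[OF V(1)] unfolding n_def by blast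
  \<comment> \<open>Row \<open>i\<close> holds chosen coefficients of \<open>x * e i\<close> in
    terms of the generators; these may be linearly dependent, so \<open>c\<close> is a
    choice.\<close>
  define A where "A = mat n n (\<lambda>(i, j). c (e i) (e j))"
  define u where "u = vec n e"
  have A: "A \<in> carrier_mat n n" by (simp add: A_def)
  have "eigenvector (map_mat h A) u x"
    unfolding eigenvector_def
  proof (intro conjI)
    show "u \<in> carrier_vec (dim_row (map_mat h A))" by (simp add: u_def A_def)
    obtain v where v: "v \<in> V" "v \<noteq> 0" using V by blast
    then obtain i where i: "i < n" "e i = v" using e by (auto simp: bij_betw_def)
    show "u \<noteq> 0\<^sub>v (dim_row (map_mat h A))"
    proof
      assume "u = 0\<^sub>v (dim_row (map_mat h A))"
      then have "u $ i = 0" using i by (simp add: A_def)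
      then show False using i v by (simp add: u_def)
    qed
    show "map_mat h A *\<^sub>v u = x \<cdot>\<^sub>v u"
    proof (rule eq_vecI)
      fix i assume "i < dim_vec (x \<cdot>\<^sub>v u)"
      then have i: "i < n" by (simp add: u_def)
      have "(map_mat h A *\<^sub>v u) $ i = (\<Sum>j = 0..<n. h (c (e i) (e j)) * e j)"
        using i by (simp add: A_def u_def scalar_prod_def)
      also have "\<dots> = (\<Sum>w\<in>V. h (c (e i) w) * w)"
        by (rule sum.reindex_bij_betw[OF e])
      also have "\<dots> = x * e i" using c[of "e i"] e i by (auto simp: bij_betw_def)
      finally show "(map_mat h A *\<^sub>v u) $ i = (x \<cdot>\<^sub>v u) $ i" using i by (simp add: u_def)
    qed (simp add: A_def u_def)
  qed
  then have "eigenvalue (map_mat h A) x" by (auto simp: eigenvalue_def)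
  then have "poly (char_poly (map_mat h A)) x = 0"
    using eigenvalue_root_char_poly[of "map_mat h A" n x] A by simp
  \<comment> \<open>The characteristic polynomial is formed before \<open>h\<close> is applied, so
    the monic polynomial found has its coefficients in \<open>'r\<close>.\<close>
  then have "poly (map_poly h (char_poly A)) x = 0" by (simp add: char_poly_hom[OF A])
  then show ?thesis using degree_monic_char_poly[OF A] by auto
qed

section \<open>Closure of the algebraic integers under difference and product\<close>

text \<open>This is the additive subgroup generated by a set. As a separate constant it is what the
  interpretation below rewrites the module span to.\<close>

definition int_span :: "'k::field_char_0 set \<Rightarrow> 'k set" where
  "int_span = Modules.module.span (\<lambda>(r::int) x. of_int r * x)"

interpretation int_span: Modules.module "\<lambda>(r::int) (x::'k::field_char_0). of_int r * x"
  rewrites "Modules.module.span (\<lambda>(r::int) (x::'k::field_char_0). of_int r * x) = int_span"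
  by (rule module_hom_scale) (unfold_locales, simp add: int_span_def)

text \<open>The usual integrality criterion; the generator 1 supplies the nonzero entry of the
  eigenvector.\<close>

lemma algebraic_int_if_mult_int_span:
  fixes x :: "'k::field_char_0"
  assumes "finite V" "1 \<in> V" "\<And>v. v \<in> V \<Longrightarrow> x * v \<in> int_span V"
  shows "algebraic_int x"
proof -
  have "\<exists>v\<in>V. v \<noteq> 0" using assms(2) by (intro bexI[of _ 1]) simp_all
  then have "\<exists>p. lead_coeff p = 1 \<and> poly (map_poly of_int p) x = 0"
    using assms unfolding int_span_def
    by (intro monic_root_if_mult_span of_int_hom.comm_ring_hom_axioms)
  then show ?thesis by (auto simp: algebraic_int_altdef_ipoly)
qed

text \<open>Needed for products: \<open>y * v\<close> lies only in the span, so stability under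
  \<open>x\<close> has to extend from the generators by linearity.\<close>

lemma mult_int_span:
  assumes x: "\<And>v. v \<in> V \<Longrightarrow> x * v \<in> int_span V" and w: "w \<in> int_span V"
  shows "x * w \<in> int_span V"
  using w
proof (induction rule: int_span.span_induct_alt)
  case base
  then show ?case by (simp add: int_span.span_zero)
next
  case (step c v y)
  have "x * (of_int c * v + y) = of_int c * (x * v) + x * y" by (simp add: algebra_simps)
  then show ?case
    using step x by (simp add: int_span.span_add int_span.span_scale)
qed

lemma algebraic_int_power_reduce:
  fixes x :: "'k::field_char_0"
  assumes "algebraic_int x"
  obtains m c where "m > 0" "x ^ m = (\<Sum>i<m. of_int (c i) * x ^ i)"
proof -
  obtain p where p: "poly (map_poly of_int p) x = 0" "lead_coeff p = 1"
    using assms by (auto simp: algebraic_int_altdef_ipoly)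
  \<comment> \<open>A monic constant is 1 and has no root. Positivity later puts 1 among the
    generating monomials.\<close>
  have "degree p > 0"
  proof (rule ccontr)
    assume "\<not> degree p > 0"
    then obtain a where "p = [:a:]" by (metis degree_eq_zeroE gr0I)
    with p show False by simp
  qed
  moreover have "x ^ degree p = (\<Sum>i<degree p. of_int (- coeff p i) * x ^ i)"
    using p by (simp add: poly_altdef lessThan_Suc_atMost[symmetric] sum_negf
        eq_neg_iff_add_eq_0 add.commute)
  ultimately show ?thesis by (rule that)
qed

text \<open>The monomials \<open>x ^ i * y ^ j\<close> with both exponents below the degrees of
  monic equations generate a common stable subgroup: multiplication raises one exponent, and an
  overflow is reduced by the corresponding equation.\<close>

lemma algebraic_int_pair_int_span:
  fixes x y :: "'k::field_char_0"
  assumes "algebraic_int x" "algebraic_int y"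
  obtains V where "finite V" "1 \<in> V" "\<forall>v\<in>V. x * v \<in> int_span V" "\<forall>v\<in>V. y * v \<in> int_span V"
proof -
  obtain m a where m: "m > 0" "x ^ m = (\<Sum>i<m. of_int (a i) * x ^ i)"
    using assms(1) by (rule algebraic_int_power_reduce)
  obtain n b where n: "n > 0" "y ^ n = (\<Sum>i<n. of_int (b i) * y ^ i)"
    using assms(2) by (rule algebraic_int_power_reduce)
  define V where "V = (\<lambda>(i, j). x ^ i * y ^ j) ` ({..<m} \<times> {..<n})"
  have V: "x ^ i * y ^ j \<in> int_span V" if "i < m" "j < n" for i j
    using that by (auto intro!: int_span.span_base simp: V_def)
  have "finite V" "1 \<in> V"
    using m n by (auto simp: V_def intro!: image_eqI[of _ _ "(0, 0)"])
  moreover have "x * v \<in> int_span V \<and> y * v \<in> int_span V" if "v \<in> V" for v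
  proof
    from that obtain i j where ij: "i < m" "j < n" "v = x ^ i * y ^ j" by (auto simp: V_def)
    show "x * v \<in> int_span V"
    proof (cases "Suc i = m")
      case True
      have "x * v = x ^ m * y ^ j" using True ij by auto
      also have "\<dots> = (\<Sum>i<m. of_int (a i) * (x ^ i * y ^ j))"
        by (simp add: m(2) sum_distrib_right mult.assoc)
      finally show ?thesis using ij V by (auto intro!: int_span.span_sum int_span.span_scale)
    next
      case False
      then show ?thesis using ij V[of "Suc i" j] by (simp add: mult.assoc)
    qed
    show "y * v \<in> int_span V"
    proof (cases "Suc j = n")
      case True
      have "y * v = x ^ i * y ^ n" using True ij by auto
      also have "\<dots> = (\<Sum>j<n. of_int (b j) * (x ^ i * y ^ j))"
        by (simp add: n(2) sum_distrib_left mult.left_commute)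
      finally show ?thesis using ij V by (auto intro!: int_span.span_sum int_span.span_scale)
    next
      case False
      then show ?thesis using ij V[of i "Suc j"] by (simp add: mult.left_commute)
    qed
  qed
  ultimately show ?thesis by (intro that[of V]) simp_all
qed

lemma algebraic_int_diff:
  fixes x y :: "'k::field_char_0"
  assumes "algebraic_int x" "algebraic_int y"
  shows "algebraic_int (x - y)"
proof -
  obtain V where V: "finite V" "1 \<in> V" "\<forall>v\<in>V. x * v \<in> int_span V" "\<forall>v\<in>V. y * v \<in> int_span V"
    using assms by (rule algebraic_int_pair_int_span)
  show ?thesis
    using V by (intro algebraic_int_if_mult_int_span[of V])
      (simp_all add: left_diff_distrib int_span.span_diff)
qed

lemma algebraic_int_mult:
  fixes x y :: "'k::field_char_0"
  assumes "algebraic_int x" "algebraic_int y"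
  shows "algebraic_int (x * y)"
proof -
  obtain V where V: "finite V" "1 \<in> V" "\<forall>v\<in>V. x * v \<in> int_span V" "\<forall>v\<in>V. y * v \<in> int_span V"
    using assms by (rule algebraic_int_pair_int_span)
  show ?thesis
    using V by (intro algebraic_int_if_mult_int_span[of V])
      (simp_all add: mult.assoc mult_int_span)
qed

lemma algebraic_int_prod:
  fixes f :: "'i \<Rightarrow> 'k::field_char_0"
  assumes "\<And>i. i \<in> I \<Longrightarrow> algebraic_int (f i)"
  shows "algebraic_int (\<Prod>i\<in>I. f i)"
  using assms by (induction I rule: infinite_finite_induct) (auto intro: algebraic_int_mult)

section \<open>Field homomorphisms and roots of polynomials\<close>

lemma field_hom_if_on_UNIV:
  fixes f :: "'a::field \<Rightarrow> 'b::field"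
  assumes "field_hom_on_UNIV f"
  shows "field_hom f"
proof -
  \<comment> \<open>Preservation of 0 is not part of \<open>field_hom_on_UNIV\<close>; it follows
    from additivity by cancellation.\<close>
  have "f 0 + f 0 = f 0" using assms unfolding field_hom_on_UNIV_def by (metis add.right_neutral)
  then have "f 0 = 0" by (simp only: add_cancel_left_left)
  then show ?thesis using assms by unfold_locales (auto simp: field_hom_on_UNIV_def)
qed

lemma field_hom_of_rat:
  fixes f :: "'a::field_char_0 \<Rightarrow> 'b::field_char_0"
  assumes "field_hom f"
  shows "f (of_rat q) = of_rat q"
proof -
  interpret field_hom f by fact
  show ?thesis by (cases q) (simp add: of_rat_rat divide_inverse hom_mult hom_inverse hom_of_int)
qed

text \<open>Used to carry roots to roots, with integer and with rational coefficients. The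
  conditions at 0 make \<open>map_poly\<close> act coefficientwise.\<close>

lemma field_hom_poly_fixed_coeffs:
  fixes f :: "'a::field \<Rightarrow> 'b::field"
  assumes "field_hom f" "\<And>r. f (h r) = h' r" "h 0 = 0" "h' 0 = 0"
  shows "f (poly (map_poly h p) x) = poly (map_poly h' p) (f x)"
proof -
  interpret field_hom f by fact
  have "map_poly h' p = map_poly f (map_poly h p)"
    by (intro poly_eqI) (simp add: coeff_map_poly assms)
  then show ?thesis by simp
qed

lemma field_hom_algebraic_int:
  fixes f :: "'a::field_char_0 \<Rightarrow> 'b::field_char_0"
  assumes "field_hom f" "algebraic_int x"
  shows "algebraic_int (f x)"
proof -
  interpret field_hom f by fact
  obtain p where p: "poly (map_poly of_int p) x = 0" "lead_coeff p = 1"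
    using assms by (auto simp: algebraic_int_altdef_ipoly)
  then have "poly (map_poly of_int p) (f x) = 0"
    using field_hom_poly_fixed_coeffs[OF assms(1), of of_int of_int p x] by (simp add: hom_of_int)
  with p show ?thesis by (auto simp: algebraic_int_altdef_ipoly)
qed

section \<open>Finiteness of the set of embeddings\<close>

text \<open>The span of \<open>B\<close> is the whole field, hence stable under multiplication by
  \<open>x\<close>, and the eigenvector argument applies with rational coefficients.\<close>

lemma algebraic_if_finite_span:
  fixes B :: "'k::field_char_0 set" and x :: 'k
  assumes "finite B" "Modules.module.span (\<lambda>(q::rat) x. of_rat q * x) B = UNIV"
  obtains p :: "rat poly" where "p \<noteq> 0" "poly (map_poly of_rat p) x = 0"
proof -
  have h: "comm_ring_hom (of_rat :: rat \<Rightarrow> 'k)" by unfold_locales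
  interpret m: Modules.module "\<lambda>(q::rat) (x::'k). of_rat q * x" using h by (rule module_hom_scale)
  \<comment> \<open>Otherwise every rational combination of \<open>B\<close> vanishes and the field
    would not contain 1.\<close>
  have "\<exists>v\<in>B. v \<noteq> 0"
  proof (rule ccontr)
    assume "\<not> (\<exists>v\<in>B. v \<noteq> 0)"
    then have "(\<Sum>v\<in>B. of_rat (c v) * v) = 0" for c by (intro sum.neutral) simp
    then have "m.span B = {0}" by (auto simp: m.span_finite[OF assms(1)])
    then have "(1::'k) \<in> {0}" using assms(2) by blast
    then show False by simp
  qed
  then obtain p :: "rat poly" where p: "lead_coeff p = 1" "poly (map_poly of_rat p) x = 0"
    using monic_root_if_mult_span[OF h assms(1), of x] assms(2) by auto
  show ?thesis by (rule that[OF _ p(2)]) (use p(1) in auto)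
qed

text \<open>An embedding fixes the rationals, so it is determined by its values on a finite spanning
  set, and each value is one of the finitely many complex roots of a rational polynomial.\<close>

lemma finite_Emb:
  assumes "finite_galois_over_rat TYPE('k::field_char_0)"
  shows "finite (Emb :: ('k \<Rightarrow> complex) set)"
proof -
  obtain B :: "'k set" where B: "finite B" "Modules.module.span (\<lambda>(q::rat) x. of_rat q * x) B = UNIV"
    using assms by (auto simp: finite_galois_over_rat_def)
  have "comm_ring_hom (of_rat :: rat \<Rightarrow> 'k)" by unfold_locales
  then interpret m: Modules.module "\<lambda>(q::rat) (x::'k). of_rat q * x" by (rule module_hom_scale)
  have "\<exists>p::rat poly. p \<noteq> 0 \<and> poly (map_poly of_rat p) x = 0" for x :: 'k
    by (rule algebraic_if_finite_span[OF B, of x]) (intro exI conjI)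
  then have "\<exists>P::'k \<Rightarrow> rat poly. \<forall>x. P x \<noteq> 0 \<and> poly (map_poly of_rat (P x)) x = 0"
    by (intro choice allI)
  then obtain P :: "'k \<Rightarrow> rat poly"
    where "\<forall>x. P x \<noteq> 0 \<and> poly (map_poly of_rat (P x)) x = 0" ..
  then have P: "P x \<noteq> 0" "poly (map_poly of_rat (P x)) x = 0" for x by simp_all
  have sub: "(\<lambda>\<tau>. restrict \<tau> B) ` Emb \<subseteq>
    (\<Pi>\<^sub>E b\<in>B. {y::complex. poly (map_poly of_rat (P b)) y = 0})"
  proof clarsimp
    fix \<tau> :: "'k \<Rightarrow> complex" and b assume "\<tau> \<in> Emb"
    then have \<tau>: "field_hom \<tau>" by (simp add: Emb_def field_hom_if_on_UNIV)
    then interpret field_hom \<tau> .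
    show "poly (map_poly of_rat (P b)) (\<tau> b) = 0"
      using field_hom_poly_fixed_coeffs[OF \<tau>, of of_rat of_rat "P b" b]
      by (simp add: P field_hom_of_rat[OF \<tau>])
  qed
  have fin: "finite (\<Pi>\<^sub>E b\<in>B. {y::complex. poly (map_poly of_rat (P b)) y = 0})"
    using B(1) P(1) by (intro finite_PiE poly_roots_finite) auto
  have "inj_on (\<lambda>\<tau>. restrict \<tau> B) (Emb :: ('k \<Rightarrow> complex) set)"
  proof (intro inj_onI ext)
    fix \<tau> \<tau>' :: "'k \<Rightarrow> complex" and x
    assume "\<tau> \<in> Emb" "\<tau>' \<in> Emb" and eq: "restrict \<tau> B = restrict \<tau>' B"
    then have t: "field_hom \<tau>" "field_hom \<tau>'" by (simp_all add: Emb_def field_hom_if_on_UNIV)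
    interpret t: field_hom \<tau> by fact
    interpret t': field_hom \<tau>' by fact
    have "x \<in> m.span B" by (simp add: B)
    then obtain c where x: "x = (\<Sum>b\<in>B. of_rat (c b) * b)" by (auto simp: m.span_finite[OF B(1)])
    have "\<tau> b = \<tau>' b" if "b \<in> B" for b using fun_cong[OF eq, of b] that by simp
    then show "\<tau> x = \<tau>' x"
      by (simp add: x t.hom_sum t'.hom_sum t.hom_mult t'.hom_mult t[THEN field_hom_of_rat])
  qed
  then show ?thesis using finite_subset[OF sub fin] finite_imageD by blast
qed

section \<open>Automorphisms and small algebraic integers\<close>

lemma Gal_inv:
  assumes "\<sigma> \<in> Gal"
  shows "inv_into UNIV \<sigma> \<in> Gal"
proof -
  have b: "bij \<sigma>" and h: "field_hom_on_UNIV \<sigma>" and q: "\<And>q. \<sigma> (of_rat q) = of_rat q"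
    using assms by (auto simp: Gal_def)
  have *: "inv_into UNIV \<sigma> y = x" if "\<sigma> x = y" for x y using b that by (simp add: bij_is_inj inv_f_eq)
  have s: "\<sigma> (inv_into UNIV \<sigma> x) = x" for x using b by (simp add: bij_is_surj surj_f_inv_f)
  show ?thesis using h q b
    by (auto simp: Gal_def bij_imp_bij_inv field_hom_on_UNIV_def s intro!: *)
qed

lemma Gal_comp:
  assumes "\<sigma> \<in> Gal" "\<rho> \<in> Gal"
  shows "\<sigma> \<circ> \<rho> \<in> Gal"
  using assms by (auto simp: Gal_def bij_comp field_hom_on_UNIV_def)

lemma Emb_comp_Gal:
  assumes "\<tau> \<in> Emb" "\<sigma> \<in> Gal"
  shows "\<tau> \<circ> \<sigma> \<in> Emb"
  using assms by (auto simp: Emb_def Gal_def field_hom_on_UNIV_def)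

text \<open>The product of the distinct Galois conjugates is a rational algebraic integer, and it has
  absolute value less than 1 under any embedding.\<close>

lemma algebraic_int_small_eq_0:
  fixes x :: "'k::field_char_0"
  assumes K: "finite_galois_over_rat TYPE('k)"
    and x: "algebraic_int x"
    and small: "\<And>\<tau>. \<tau> \<in> Emb \<Longrightarrow> cmod (\<tau> x) < 1"
    and ne: "(Emb :: ('k \<Rightarrow> complex) set) \<noteq> {}"
  shows "x = 0"
proof -
  define C where "C = (\<lambda>\<sigma>. \<sigma> x) ` Gal"
  have hom: "field_hom \<sigma>" if "\<sigma> \<in> Gal" for \<sigma> :: "'k \<Rightarrow> 'k"
    using that by (simp add: Gal_def field_hom_if_on_UNIV)
  have "id \<in> Gal" by (auto simp: Gal_def field_hom_on_UNIV_def)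
  then have xC: "x \<in> C" by (auto simp: C_def intro!: image_eqI[of _ _ id])
  obtain p where p: "poly (map_poly of_int p) x = 0" "lead_coeff p = 1"
    using x by (auto simp: algebraic_int_altdef_ipoly)
  \<comment> \<open>Finiteness is obtained for the orbit, whose elements are roots of
    \<open>p\<close>, rather than for the group.\<close>
  have "C \<subseteq> {y. poly (map_poly of_int p) y = 0}"
  proof (clarsimp simp: C_def)
    fix \<sigma> :: "'k \<Rightarrow> 'k" assume "\<sigma> \<in> Gal"
    then interpret field_hom \<sigma> by (rule hom)
    show "poly (map_poly of_int p) (\<sigma> x) = 0"
      using field_hom_poly_fixed_coeffs[OF field_hom_axioms, of of_int of_int p x]
      by (simp add: p hom_of_int)
  qed
  moreover have "finite {y::'k. poly (map_poly of_int p) y = 0}"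
    using p by (intro poly_roots_finite) auto
  ultimately have fin: "finite C" by (rule finite_subset)
  define N where "N = (\<Prod>y\<in>C. y)"
  have "\<sigma> N = N" if s: "\<sigma> \<in> Gal" for \<sigma>
  proof -
    interpret field_hom \<sigma> using s by (rule hom)
    have inj: "inj_on \<sigma> C" using s by (auto simp: Gal_def bij_def intro: inj_on_subset)
    have "\<sigma> ` C \<subseteq> C"
      using Gal_comp[OF s] by (auto simp: C_def image_iff) (metis comp_apply)
    \<comment> \<open>An injective self-map of a finite set permutes it, so \<open>\<sigma>\<close>
      merely reorders the factors of \<open>N\<close>.\<close>
    then have C: "\<sigma> ` C = C" using fin inj by (simp add: endo_inj_surj)
    have "(\<Prod>y\<in>\<sigma> ` C. y) = (\<Prod>y\<in>C. \<sigma> y)" by (simp add: prod.reindex[OF inj])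
    then show ?thesis unfolding N_def hom_prod C by (rule sym)
  qed
  \<comment> \<open>The Galois hypothesis enters here: what all automorphisms fix is
    rational.\<close>
  then have "N \<in> \<rat>" using K by (auto simp: finite_galois_over_rat_def Rats_def)
  moreover have "algebraic_int N"
    unfolding N_def by (rule algebraic_int_prod) (auto simp: C_def intro: field_hom_algebraic_int hom x)
  ultimately obtain k where k: "N = of_int k"
    using rational_algebraic_int_is_int by (auto elim: Ints_cases)
  obtain \<tau> :: "'k \<Rightarrow> complex" where \<tau>: "\<tau> \<in> Emb" using ne by blast
  then interpret t: field_hom \<tau> by (simp add: Emb_def field_hom_if_on_UNIV)
  \<comment> \<open>The value of \<open>\<tau>\<close> at a conjugate of \<open>x\<close> is the
    value of another embedding at \<open>x\<close> itself.\<close>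
  have lt: "cmod (\<tau> y) < 1" if "y \<in> C" for y
    using that small[OF Emb_comp_Gal[OF \<tau>]] by (auto simp: C_def)
  have "(\<Prod>y\<in>C. cmod (\<tau> y)) < (\<Prod>y\<in>C. 1)"
    by (rule prod_mono_strict[OF xC])
      (use fin lt[OF xC] in \<open>simp_all add: less_imp_le[OF lt]\<close>)
  then have "cmod (\<tau> N) < 1" by (simp add: N_def t.hom_prod prod_norm)
  then have "k = 0" by (simp add: k t.hom_of_int)
  \<comment> \<open>A vanishing product has a vanishing factor, that is, a conjugate equal to 0;
    injectivity of the automorphism then gives \<open>x = 0\<close>.\<close>
  then have "0 \<in> C" using k fin by (auto simp: N_def)
  then obtain \<sigma> where s: "\<sigma> \<in> Gal" "\<sigma> x = 0" by (auto simp: C_def)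
  interpret s: field_hom \<sigma> using s(1) by (rule hom)
  show ?thesis using s(2) by simp
qed

section \<open>Naturality under the Galois action\<close>

lemma inv_inv_Gal: "\<sigma> \<in> Gal \<Longrightarrow> inv_into UNIV (inv_into UNIV \<sigma>) = \<sigma>"
  by (simp add: Gal_def inv_inv_eq)

lemma Gal_comp_inv:
  assumes "\<sigma> \<in> Gal"
  shows "\<sigma> \<circ> inv_into UNIV \<sigma> = id" "inv_into UNIV \<sigma> \<circ> \<sigma> = id"
  using assms by (simp_all add: Gal_def bij_is_surj bij_is_inj surj_iff[symmetric])

text \<open>The order on growth tuples and the product over \<open>Emb\<close> are invariant by
  reindexing along this permutation, whose inverse is precomposition with
  \<open>\<sigma>\<close>.\<close>

lemma bij_betw_Emb:
  assumes "\<sigma> \<in> Gal"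
  shows "bij_betw (\<lambda>\<tau>. \<tau> \<circ> inv_into UNIV \<sigma>) Emb Emb"
proof (rule bij_betw_byWitness[where f' = "\<lambda>\<tau>. \<tau> \<circ> \<sigma>"])
  show "\<forall>\<tau>\<in>Emb. \<tau> \<circ> inv_into UNIV \<sigma> \<circ> \<sigma> = \<tau>"
    by (simp add: comp_assoc Gal_comp_inv[OF assms])
  show "\<forall>\<tau>\<in>Emb. \<tau> \<circ> \<sigma> \<circ> inv_into UNIV \<sigma> = \<tau>"
    by (simp add: comp_assoc Gal_comp_inv[OF assms])
qed (auto intro: Emb_comp_Gal Gal_inv assms)

lemma ball_Emb_comp:
  assumes "\<sigma> \<in> Gal"
  shows "(\<forall>\<tau>\<in>Emb. P (\<tau> \<circ> inv_into UNIV \<sigma>)) \<longleftrightarrow> (\<forall>\<tau>\<in>Emb. P \<tau>)"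
  using bij_betw_imp_surj_on[OF bij_betw_Emb[OF assms]] by (metis (no_types, lifting) image_iff)

lemma gal_act_apply: "\<tau> \<in> Emb \<Longrightarrow> gal_act \<sigma> z \<tau> = z (\<tau> \<circ> inv_into UNIV \<sigma>)"
  by (simp add: gal_act_def)

text \<open>The action forgets values outside \<open>Emb\<close>, so only an extensional tuple can
  be recovered.\<close>

lemma gal_act_inv:
  assumes "\<sigma> \<in> Gal" "z \<in> extensional Emb"
  shows "gal_act (inv_into UNIV \<sigma>) (gal_act \<sigma> z) = z"
  using assms
  by (auto simp: gal_act_def fun_eq_iff inv_inv_Gal Emb_comp_Gal comp_assoc Gal_comp_inv extensional_def)

text \<open>A common form for the product and difference in Minkowski space and the product of
  growth tuples.\<close>

lemma gal_act_pointwise: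
  assumes "\<sigma> \<in> Gal"
  shows "gal_act \<sigma> (\<lambda>\<tau>\<in>Emb. h (z \<tau>) (w \<tau>)) = (\<lambda>\<tau>\<in>Emb. h (gal_act \<sigma> z \<tau>) (gal_act \<sigma> w \<tau>))"
  using Emb_comp_Gal[OF _ Gal_inv[OF assms]] by (auto simp: gal_act_def fun_eq_iff)

lemma gal_act_mink_mult:
  "\<sigma> \<in> Gal \<Longrightarrow> gal_act \<sigma> (mink_mult z w) = mink_mult (gal_act \<sigma> z) (gal_act \<sigma> w)"
  unfolding mink_mult_def by (rule gal_act_pointwise)

lemma gal_act_mink_diff:
  "\<sigma> \<in> Gal \<Longrightarrow> gal_act \<sigma> (mink_diff z w) = mink_diff (gal_act \<sigma> z) (gal_act \<sigma> w)"
  unfolding mink_diff_def by (rule gal_act_pointwise)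

lemma gal_act_PK_mult:
  "\<sigma> \<in> Gal \<Longrightarrow> gal_act \<sigma> (PK_mult U \<mu> \<nu>) = PK_mult U (gal_act \<sigma> \<mu>) (gal_act \<sigma> \<nu>)"
  unfolding PK_mult_def by (rule gal_act_pointwise)

text \<open>Coordinates are read at \<open>\<tau> \<circ> inv_into UNIV \<sigma>\<close>, so the
  permutation acts on the embedded field as the inverse automorphism.\<close>

lemma gal_act_mink_embed:
  "\<sigma> \<in> Gal \<Longrightarrow> gal_act \<sigma> (mink_embed \<alpha>) = mink_embed (inv_into UNIV \<sigma> \<alpha>)"
  using Emb_comp_Gal[OF _ Gal_inv] by (auto simp: gal_act_def mink_embed_def fun_eq_iff)

lemma cnj_comp_Emb: "\<tau> \<in> Emb \<Longrightarrow> cnj \<circ> \<tau> \<in> Emb"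
  by (simp add: Emb_def field_hom_on_UNIV_def)

text \<open>Conjugation composes with an embedding on the left and the automorphism on the right, so
  the two commute by associativity.\<close>

lemma gal_act_Mink:
  assumes "\<sigma> \<in> Gal" "z \<in> Mink"
  shows "gal_act \<sigma> z \<in> Mink"
  using assms Emb_comp_Gal[OF _ Gal_inv[OF assms(1)]]
  by (auto simp: Mink_def gal_act_def cnj_comp_Emb comp_assoc)

lemma gal_act_PK:
  assumes "\<sigma> \<in> Gal" "\<mu> \<in> PK U"
  shows "gal_act \<sigma> \<mu> \<in> PK U"
  using assms Emb_comp_Gal[OF _ Gal_inv[OF assms(1)]]
  by (auto simp: PK_def gal_act_def cnj_comp_Emb comp_assoc)

text \<open>The action reorders the factors of the product over \<open>Emb\<close>, which leaves its
  value in a commutative monoid unchanged.\<close>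

lemma gal_act_PK_Neps:
  assumes U: "nonprincipal_ultrafilter U" and \<sigma>: "\<sigma> \<in> Gal" and \<mu>: "\<mu> \<in> PK_Neps U"
  shows "gal_act \<sigma> \<mu> \<in> PK_Neps U"
proof -
  interpret PP: comm_monoid "PP_monoid U" using U by (rule comm_monoid_PP)
  have PK: "\<mu> \<in> PK U" using \<mu> by (simp add: PK_Neps_def)
  have "finprod (PP_monoid U) (gal_act \<sigma> \<mu>) Emb =
      finprod (PP_monoid U) (\<lambda>\<tau>. \<mu> (\<tau> \<circ> inv_into UNIV \<sigma>)) Emb"
    using PK Emb_comp_Gal[OF _ Gal_inv[OF \<sigma>]]
    by (intro PP.finprod_cong') (auto simp: gal_act_apply PK_def PP_monoid_def)
  also have "\<dots> = finprod (PP_monoid U) \<mu> ((\<lambda>\<tau>. \<tau> \<circ> inv_into UNIV \<sigma>) ` Emb)"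
  proof (rule PP.finprod_reindex[symmetric])
    show "\<mu> \<in> (\<lambda>\<tau>. \<tau> \<circ> inv_into UNIV \<sigma>) ` Emb \<rightarrow> carrier (PP_monoid U)"
      unfolding bij_betw_imp_surj_on[OF bij_betw_Emb[OF \<sigma>]]
      using PK by (auto simp: PK_def PP_monoid_def)
  qed (rule bij_betw_imp_inj_on[OF bij_betw_Emb[OF \<sigma>]])
  also have "\<dots> = finprod (PP_monoid U) \<mu> Emb"
    by (simp only: bij_betw_imp_surj_on[OF bij_betw_Emb[OF \<sigma>]])
  finally show ?thesis using \<mu> gal_act_PK[OF \<sigma> PK] by (simp add: PK_Neps_def)
qed

lemma PK_le_gal_act:
  "\<sigma> \<in> Gal \<Longrightarrow> PK_le U (gal_act \<sigma> \<mu>) (gal_act \<sigma> \<nu>) \<longleftrightarrow> PK_le U \<mu> \<nu>"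
  using ball_Emb_comp[of \<sigma> "\<lambda>\<tau>. growth_le U (\<mu> \<tau>) (\<nu> \<tau>)"]
  by (simp add: PK_le_def gal_act_apply)

lemma PK_less_gal_act:
  "\<sigma> \<in> Gal \<Longrightarrow> PK_less U (gal_act \<sigma> \<mu>) (gal_act \<sigma> \<nu>) \<longleftrightarrow> PK_less U \<mu> \<nu>"
  using ball_Emb_comp[of \<sigma> "\<lambda>\<tau>. growth_less U (\<mu> \<tau>) (\<nu> \<tau>)"]
  by (simp add: PK_less_def gal_act_apply)

section \<open>The action on ultrapowers\<close>

text \<open>The representative lies in \<open>A\<close> at every index, not just almost everywhere,
  so pointwise facts apply to it directly.\<close>

lemma ultrapowerE:
  assumes "X \<in> ultrapower U A"
  obtains f where "X = uclass U f" "\<And>n. f n \<in> A"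
  using assms by (auto simp: ultrapower_eq)

lemma umap_ultrapower:
  assumes "X \<in> ultrapower U A" "\<And>a. a \<in> A \<Longrightarrow> h a \<in> B"
  shows "umap U h X \<in> ultrapower U B"
  using assms(1) by (rule ultrapowerE) (auto simp: umap_uclass ultrapower_eq assms(2))

lemma star_gal_act_inv:
  assumes "\<sigma> \<in> Gal" "X \<in> ultrapower U A" "A \<subseteq> extensional Emb"
  shows "star_gal_act U (inv_into UNIV \<sigma>) (star_gal_act U \<sigma> X) = X"
  using assms(2)
proof (rule ultrapowerE)
  fix f assume f: "X = uclass U f" "\<And>n. f n \<in> A"
  then have "gal_act (inv_into UNIV \<sigma>) (gal_act \<sigma> (f n)) = f n" for n
    using assms by (intro gal_act_inv) auto
  then show ?thesis by (simp add: f star_gal_act_def umap_uclass)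
qed

lemma star_O_extensional: "mink_embed ` ring_of_integers \<subseteq> extensional Emb"
  by (auto simp: mink_embed_def)

text \<open>On embedded field elements the action is the inverse automorphism, and field
  homomorphisms preserve integral equations.\<close>

lemma star_gal_act_star_O:
  assumes "\<sigma> \<in> Gal" "X \<in> star_O U"
  shows "star_gal_act U \<sigma> X \<in> star_O U"
proof -
  have "field_hom (inv_into UNIV \<sigma>)"
    using Gal_inv[OF assms(1)] by (simp add: Gal_def field_hom_if_on_UNIV)
  note int = field_hom_algebraic_int[OF this]
  show ?thesis
    unfolding star_gal_act_def star_O_def
    by (rule umap_ultrapower[OF assms(2)[unfolded star_O_def]])
      (auto simp: gal_act_mink_embed[OF assms(1)] ring_of_integers_def int)
qed

lemma coord_star_gal_act:
  assumes "\<tau> \<in> Emb"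
  shows "coord U \<tau> (star_gal_act U \<sigma> (uclass U f)) = coord U (\<tau> \<circ> inv_into UNIV \<sigma>) (uclass U f)"
  using assms by (simp add: coord_def star_gal_act_def umap_uclass gal_act_apply)

lemma PK_of_star_gal_act:
  assumes "\<sigma> \<in> Gal"
  shows "PK_of U (star_gal_act U \<sigma> (uclass U f)) = gal_act \<sigma> (PK_of U (uclass U f))"
  using Emb_comp_Gal[OF _ Gal_inv[OF assms]]
  by (auto simp: PK_of_def gal_act_def coord_star_gal_act fun_eq_iff)

lemma star_gal_act_star_Mink_eps:
  assumes "\<sigma> \<in> Gal" "Z \<in> star_Mink_eps U"
  shows "star_gal_act U \<sigma> Z \<in> star_Mink_eps U"
proof -
  have Z: "Z \<in> ultrapower U Mink" using assms(2) by (simp add: star_Mink_eps_def star_Mink_def)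
  then obtain f where f: "Z = uclass U f" by (rule ultrapowerE)
  have "star_gal_act U \<sigma> Z \<in> star_Mink U"
    unfolding star_gal_act_def star_Mink_def
    using Z gal_act_Mink[OF assms(1)] by (rule umap_ultrapower)
  then show ?thesis
    using assms(2) Emb_comp_Gal[OF _ Gal_inv[OF assms(1)]]
    by (auto simp: star_Mink_eps_def f coord_star_gal_act)
qed

lemma gal_act_PK_eps:
  assumes "\<sigma> \<in> Gal" "\<mu> \<in> PK_eps U"
  shows "gal_act \<sigma> \<mu> \<in> PK_eps U"
proof -
  obtain Z where Z: "Z \<in> star_Mink_eps U" "\<mu> = PK_of U Z" using assms(2) by (auto simp: PK_eps_def)
  then have "Z \<in> ultrapower U Mink" by (simp add: star_Mink_eps_def star_Mink_def)
  then obtain f where "Z = uclass U f" by (rule ultrapowerE)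
  then show ?thesis
    using Z star_gal_act_star_Mink_eps[OF assms(1) Z(1)]
    by (auto simp: PK_eps_def PK_of_star_gal_act[OF assms(1), symmetric])
qed

text \<open>Stated for an arbitrary candidate \<open>\<beta>\<close> rather than for
  \<open>perp\<close>, so that it transports candidates first and the error term \<open>eps\<close>
  afterwards.\<close>

lemma star_gal_act_mink_diff_mult:
  assumes "\<sigma> \<in> Gal" "\<alpha> \<in> star_O U" "\<beta> \<in> star_O U"
  shows "star_gal_act U \<sigma> (umap2 U mink_diff (umap2 U mink_mult \<alpha> (ustd U z)) \<beta>) =
    umap2 U mink_diff (umap2 U mink_mult (star_gal_act U \<sigma> \<alpha>) (ustd U (gal_act \<sigma> z)))
      (star_gal_act U \<sigma> \<beta>)"
proof -
  obtain f where "\<alpha> = uclass U f" using assms(2) unfolding star_O_def by (rule ultrapowerE)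
  moreover obtain g where "\<beta> = uclass U g" using assms(3) unfolding star_O_def by (rule ultrapowerE)
  ultimately show ?thesis
    by (simp add: star_gal_act_def ustd_def umap_uclass umap2_uclass gal_act_mink_diff[OF assms(1)]
        gal_act_mink_mult[OF assms(1)])
qed

lemma is_perp_star_gal_act:
  assumes "\<sigma> \<in> Gal" "\<alpha> \<in> star_O U" "is_perp U z \<alpha> \<beta>"
  shows "is_perp U (gal_act \<sigma> z) (star_gal_act U \<sigma> \<alpha>) (star_gal_act U \<sigma> \<beta>)"
  using assms star_gal_act_mink_diff_mult[OF assms(1,2), of \<beta> z]
  by (auto simp: is_perp_def star_gal_act_star_O dest: star_gal_act_star_Mink_eps)

section \<open>Uniqueness of the integral approximation\<close>

text \<open>Finiteness of \<open>Emb\<close> merges the almost-everywhere bounds for single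
  embeddings into one; at each index where it holds, the difference is an algebraic integer small
  under all embeddings, hence 0.\<close>

lemma star_O_eq_if_close:
  fixes \<beta> \<beta>' :: "('k::field_char_0, complex) tuple ultra"
  assumes K: "finite_galois_over_rat TYPE('k)"
    and \<beta>: "\<beta> \<in> star_O U" "\<beta>' \<in> star_O U"
    and close: "\<And>\<tau>. \<tau> \<in> Emb \<Longrightarrow> urel U (\<lambda>x y. cmod (x \<tau> - y \<tau>) < 1) \<beta> \<beta>'"
  shows "\<beta> = \<beta>'"
proof -
  obtain g where g: "\<beta> = uclass U g" "\<And>n. g n \<in> mink_embed ` ring_of_integers"
    using \<beta>(1) unfolding star_O_def by (blast elim: ultrapowerE)
  obtain g' where g': "\<beta>' = uclass U g'" "\<And>n. g' n \<in> mink_embed ` ring_of_integers"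
    using \<beta>(2) unfolding star_O_def by (blast elim: ultrapowerE)
  have "\<forall>\<^sub>F n in U. \<forall>\<tau>\<in>Emb. cmod (g n \<tau> - g' n \<tau>) < 1"
    using close by (intro eventually_ball_finite finite_Emb[OF K]) (simp add: g g' urel_uclass)
  then have "\<forall>\<^sub>F n in U. g n = g' n"
  proof eventually_elim
    case (elim n)
    obtain a b where a: "g n = mink_embed a" "algebraic_int a"
      and b: "g' n = mink_embed b" "algebraic_int b"
      using g(2)[of n] g'(2)[of n] by (auto simp: ring_of_integers_def)
    show ?case
    proof (cases "(Emb :: ('k \<Rightarrow> complex) set) = {}")
      \<comment> \<open>The lemma on small algebraic integers asks for an embedding; without one,
        all tuples \<open>mink_embed a\<close> are the same function.\<close>
      case True
      then show ?thesis by (auto simp: a b mink_embed_def)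
    next
      case False
      have "cmod (\<tau> (a - b)) < 1" if \<tau>: "\<tau> \<in> Emb" for \<tau>
      proof -
        interpret field_hom \<tau> using \<tau> by (simp add: Emb_def field_hom_if_on_UNIV)
        show ?thesis using elim \<tau> by (simp add: a b mink_embed_def hom_minus)
      qed
      then have "a - b = 0"
        using False by (intro algebraic_int_small_eq_0 K algebraic_int_diff a b)
      then show ?thesis by (simp add: a b)
    qed
  qed
  then show ?thesis by (simp add: g g' uclass_eq_iff)
qed

lemma is_perp_unique:
  fixes z :: "('k::field_char_0, complex) tuple"
  assumes K: "finite_galois_over_rat TYPE('k)" and \<alpha>: "\<alpha> \<in> star_O U"
    and \<beta>: "is_perp U z \<alpha> \<beta>" "is_perp U z \<alpha> \<beta>'"
  shows "\<beta> = \<beta>'"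
proof (rule star_O_eq_if_close[OF K])
  show O: "\<beta> \<in> star_O U" "\<beta>' \<in> star_O U" using \<beta> by (simp_all add: is_perp_def)
  fix \<tau> :: "'k \<Rightarrow> complex" assume \<tau>: "\<tau> \<in> Emb"
  obtain f where f: "\<alpha> = uclass U f" using \<alpha> unfolding star_O_def by (rule ultrapowerE)
  obtain g where g: "\<beta> = uclass U g" using O(1) unfolding star_O_def by (rule ultrapowerE)
  obtain g' where g': "\<beta>' = uclass U g'" using O(2) unfolding star_O_def by (rule ultrapowerE)
  \<comment> \<open>The bound 1/2 is chosen so that two errors together stay below 1.\<close>
  have half: "\<forall>\<^sub>F n in U. cmod (f n \<tau> * z \<tau> - h n \<tau>) < 1 / 2" if "is_perp U z \<alpha> (uclass U h)" for h
  proof -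
    have "urel U (<) (umap U norm (coord U \<tau> (umap2 U mink_diff (umap2 U mink_mult \<alpha> (ustd U z))
        (uclass U h)))) (ustd U (1 / 2))"
      using that \<tau> by (simp add: is_perp_def star_Mink_eps_def infinitesimal_def)
    then show ?thesis
      using \<tau> by (simp add: f coord_def ustd_def umap_uclass umap2_uclass urel_uclass
          mink_diff_def mink_mult_def)
  qed
  have "\<forall>\<^sub>F n in U. cmod (g n \<tau> - g' n \<tau>) < 1"
    using half[OF \<beta>(1)[unfolded g]] half[OF \<beta>(2)[unfolded g']]
  proof eventually_elim
    case (elim n)
    \<comment> \<open>The common term \<open>f n \<tau> * z \<tau>\<close> cancels, leaving a
      difference of two errors.\<close>
    have "g n \<tau> - g' n \<tau> = (f n \<tau> * z \<tau> - g' n \<tau>) - (f n \<tau> * z \<tau> - g n \<tau>)" by simp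
    then show ?case
      using norm_triangle_ineq4[of "f n \<tau> * z \<tau> - g' n \<tau>" "f n \<tau> * z \<tau> - g n \<tau>"] elim by simp
  qed
  then show "urel U (\<lambda>x y. cmod (x \<tau> - y \<tau>) < 1) \<beta> \<beta>'" by (simp add: g g' urel_uclass)
qed

text \<open>By uniqueness the definite description can be evaluated at any candidate, in particular
  at one transported by \<open>\<sigma>\<close>.\<close>

lemma perp_eq:
  fixes z :: "('k::field_char_0, complex) tuple"
  assumes "finite_galois_over_rat TYPE('k)" "\<alpha> \<in> star_O U" "is_perp U z \<alpha> \<beta>"
  shows "perp U z \<alpha> = \<beta>"
  unfolding perp_def
  by (rule the_equality, rule assms(3), rule is_perp_unique[OF assms(1,2) _ assms(3)])

lemma eps_star_gal_act:
  fixes z :: "('k::field_char_0, complex) tuple"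
  assumes K: "finite_galois_over_rat TYPE('k)" and \<sigma>: "\<sigma> \<in> Gal"
    and \<alpha>: "\<alpha> \<in> star_O U" "is_perp U z \<alpha> \<beta>"
  shows "eps U (gal_act \<sigma> z) (star_gal_act U \<sigma> \<alpha>) = star_gal_act U \<sigma> (eps U z \<alpha>)"
proof -
  have "\<beta> \<in> star_O U" using \<alpha>(2) by (simp add: is_perp_def)
  then show ?thesis
    unfolding eps_def perp_eq[OF K \<alpha>]
      perp_eq[OF K star_gal_act_star_O[OF \<sigma> \<alpha>(1)] is_perp_star_gal_act[OF \<sigma> \<alpha>]]
    by (rule star_gal_act_mink_diff_mult[OF \<sigma> \<alpha>(1), symmetric])
qed

section \<open>Transport of the approximation groups\<close>

lemma star_gal_act_dioph_gd:
  fixes z :: "('k::field_char_0, complex) tuple"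
  assumes K: "finite_galois_over_rat TYPE('k)" and \<sigma>: "\<sigma> \<in> Gal"
    and \<alpha>: "\<alpha> \<in> dioph_gd U \<mu> \<nu> z"
  shows "star_gal_act U \<sigma> \<alpha> \<in> dioph_gd U (gal_act \<sigma> \<mu>) (gal_act \<sigma> \<nu>) (gal_act \<sigma> z)"
proof -
  obtain \<beta> where \<beta>: "\<alpha> \<in> star_O U" "is_perp U z \<alpha> \<beta>"
    using \<alpha> by (auto simp: dioph_gd_def dioph_def)
  have \<beta>O: "\<beta> \<in> star_O U" using \<beta>(2) by (simp add: is_perp_def)
  obtain f where f: "\<alpha> = uclass U f" using \<beta>(1) unfolding star_O_def by (rule ultrapowerE)
  obtain g where g: "\<beta> = uclass U g" using \<beta>O unfolding star_O_def by (rule ultrapowerE)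
  \<comment> \<open>Exhibiting the error as the class of a sequence makes
    \<open>PK_of_star_gal_act\<close> applicable to it.\<close>
  have e: "eps U z \<alpha> = uclass U (\<lambda>n. mink_diff (mink_mult (f n) z) (g n))"
    unfolding eps_def perp_eq[OF K \<beta>] by (simp add: f g ustd_def umap2_uclass)
  have "star_gal_act U \<sigma> \<alpha> \<in> dioph U (gal_act \<sigma> z)"
    using star_gal_act_star_O[OF \<sigma> \<beta>(1)] is_perp_star_gal_act[OF \<sigma> \<beta>] by (auto simp: dioph_def)
  moreover have "PK_mult U (PK_of U (star_gal_act U \<sigma> \<alpha>)) (gal_act \<sigma> \<mu>) \<in> PK_eps U"
    using \<alpha> gal_act_PK_eps[OF \<sigma>]
    by (simp add: f PK_of_star_gal_act[OF \<sigma>] gal_act_PK_mult[OF \<sigma>, symmetric] dioph_gd_def)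
  moreover have "PK_le U (PK_of U (eps U (gal_act \<sigma> z) (star_gal_act U \<sigma> \<alpha>))) (gal_act \<sigma> \<nu>)"
    using \<alpha> unfolding eps_star_gal_act[OF K \<sigma> \<beta>]
    by (simp add: e PK_of_star_gal_act[OF \<sigma>] PK_le_gal_act[OF \<sigma>] dioph_gd_def)
  ultimately show ?thesis by (simp add: dioph_gd_def)
qed

lemma star_gal_act_dioph_gd_fine:
  fixes z :: "('k::field_char_0, complex) tuple"
  assumes K: "finite_galois_over_rat TYPE('k)" and \<sigma>: "\<sigma> \<in> Gal"
    and \<alpha>: "\<alpha> \<in> dioph_gd_fine U \<mu> \<iota> \<nu> z"
  shows "star_gal_act U \<sigma> \<alpha> \<in>
    dioph_gd_fine U (gal_act \<sigma> \<mu>) (gal_act \<sigma> \<iota>) (gal_act \<sigma> \<nu>) (gal_act \<sigma> z)"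
proof -
  have "\<alpha> \<in> star_O U" using \<alpha> by (auto simp: dioph_gd_fine_def dioph_gd_def dioph_def)
  then obtain f where f: "\<alpha> = uclass U f" unfolding star_O_def by (rule ultrapowerE)
  show ?thesis
    using \<alpha> star_gal_act_dioph_gd[OF K \<sigma>, of \<alpha> U \<mu> \<nu> z]
    by (simp add: dioph_gd_fine_def f PK_of_star_gal_act[OF \<sigma>] gal_act_PK_mult[OF \<sigma>, symmetric]
        PK_less_gal_act[OF \<sigma>])
qed

lemma star_gal_act_inv_star_O:
  assumes "\<sigma> \<in> Gal" "\<alpha> \<in> star_O U"
  shows "star_gal_act U (inv_into UNIV \<sigma>) (star_gal_act U \<sigma> \<alpha>) = \<alpha>"
    "star_gal_act U \<sigma> (star_gal_act U (inv_into UNIV \<sigma>) \<alpha>) = \<alpha>"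
  using star_gal_act_inv[OF _ assms(2)[unfolded star_O_def] star_O_extensional, of \<sigma>]
    star_gal_act_inv[OF _ assms(2)[unfolded star_O_def] star_O_extensional, of "inv_into UNIV \<sigma>"]
    assms(1) by (simp_all add: Gal_inv inv_inv_Gal)

lemma extensional_Mink: "z \<in> Mink \<Longrightarrow> z \<in> extensional Emb"
  by (auto simp: Mink_def PiE_def)

lemma extensional_PK_Neps: "\<mu> \<in> PK_Neps U \<Longrightarrow> \<mu> \<in> extensional Emb"
  by (auto simp: PK_Neps_def PK_def PiE_def)

text \<open>The converse is the forward inclusion for the inverse automorphism; extensionality of
  the three tuples makes the two actions cancel.\<close>

lemma star_gal_act_dioph_gd_iff:
  fixes z :: "('k::field_char_0, complex) tuple"
  assumes K: "finite_galois_over_rat TYPE('k)" and \<sigma>: "\<sigma> \<in> Gal"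
    and ext: "\<mu> \<in> extensional Emb" "\<nu> \<in> extensional Emb" "z \<in> extensional Emb"
    and \<alpha>: "\<alpha> \<in> star_O U"
  shows "star_gal_act U \<sigma> \<alpha> \<in> dioph_gd U (gal_act \<sigma> \<mu>) (gal_act \<sigma> \<nu>) (gal_act \<sigma> z) \<longleftrightarrow>
    \<alpha> \<in> dioph_gd U \<mu> \<nu> z"
  using star_gal_act_dioph_gd[OF K \<sigma>, of \<alpha> U \<mu> \<nu> z]
    star_gal_act_dioph_gd[OF K Gal_inv[OF \<sigma>], of "star_gal_act U \<sigma> \<alpha>" U
      "gal_act \<sigma> \<mu>" "gal_act \<sigma> \<nu>" "gal_act \<sigma> z"]
  by (auto simp: gal_act_inv[OF \<sigma>] ext star_gal_act_inv_star_O[OF \<sigma> \<alpha>])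

lemma star_gal_act_image_dioph_gd_fine:
  fixes z :: "('k::field_char_0, complex) tuple"
  assumes K: "finite_galois_over_rat TYPE('k)" and \<sigma>: "\<sigma> \<in> Gal"
    and ext: "\<mu> \<in> extensional Emb" "\<iota> \<in> extensional Emb" "\<nu> \<in> extensional Emb" "z \<in> extensional Emb"
  shows "star_gal_act U \<sigma> ` dioph_gd_fine U \<mu> \<iota> \<nu> z =
    dioph_gd_fine U (gal_act \<sigma> \<mu>) (gal_act \<sigma> \<iota>) (gal_act \<sigma> \<nu>) (gal_act \<sigma> z)" (is "_ = ?R")
proof (intro subset_antisym subsetI)
  fix \<alpha> assume \<alpha>: "\<alpha> \<in> ?R"
  \<comment> \<open>Acting by the inverse automorphism gives the required preimage of
    \<open>\<alpha>\<close>.\<close>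
  have "star_gal_act U (inv_into UNIV \<sigma>) \<alpha> \<in> dioph_gd_fine U \<mu> \<iota> \<nu> z"
    using star_gal_act_dioph_gd_fine[OF K Gal_inv[OF \<sigma>] \<alpha>] by (simp add: gal_act_inv[OF \<sigma>] ext)
  moreover have "\<alpha> \<in> star_O U"
    using \<alpha> by (simp add: dioph_gd_fine_def dioph_gd_def dioph_def)
  ultimately show "\<alpha> \<in> star_gal_act U \<sigma> ` dioph_gd_fine U \<mu> \<iota> \<nu> z"
    using star_gal_act_inv_star_O(2)[OF \<sigma>] by (metis imageI)
qed (auto intro: star_gal_act_dioph_gd_fine[OF K \<sigma>])

section \<open>Composability and divisor status\<close>

text \<open>Composability compares the approximation groups with the zero group, which the action
  must therefore fix.\<close>

lemma star_gal_act_zero: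
  assumes "\<sigma> \<in> Gal"
  shows "star_gal_act U \<sigma> (ustd U (mink_embed 0)) = ustd U (mink_embed 0)"
proof -
  interpret field_hom "inv_into UNIV \<sigma>"
    using Gal_inv[OF assms] by (simp add: Gal_def field_hom_if_on_UNIV)
  show ?thesis using assms by (simp add: star_gal_act_def ustd_def umap_uclass gal_act_mink_embed)
qed

lemma star_gal_act_image_dioph_gd:
  fixes z :: "('k::field_char_0, complex) tuple"
  assumes K: "finite_galois_over_rat TYPE('k)" and \<sigma>: "\<sigma> \<in> Gal"
    and ext: "\<mu> \<in> extensional Emb" "\<nu> \<in> extensional Emb" "z \<in> extensional Emb"
  shows "star_gal_act U \<sigma> ` dioph_gd U \<mu> \<nu> z =
    dioph_gd U (gal_act \<sigma> \<mu>) (gal_act \<sigma> \<nu>) (gal_act \<sigma> z)" (is "_ = ?R")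
proof (intro subset_antisym subsetI)
  fix \<alpha> assume \<alpha>: "\<alpha> \<in> ?R"
  have "star_gal_act U (inv_into UNIV \<sigma>) \<alpha> \<in> dioph_gd U \<mu> \<nu> z"
    using star_gal_act_dioph_gd[OF K Gal_inv[OF \<sigma>] \<alpha>] by (simp add: gal_act_inv[OF \<sigma>] ext)
  moreover have "\<alpha> \<in> star_O U"
    using \<alpha> by (simp add: dioph_gd_def dioph_def)
  ultimately show "\<alpha> \<in> star_gal_act U \<sigma> ` dioph_gd U \<mu> \<nu> z"
    using star_gal_act_inv_star_O(2)[OF \<sigma>] by (metis imageI)
qed (auto intro: star_gal_act_dioph_gd[OF K \<sigma>])

text \<open>Each of the two sets is the image of the other, under \<open>\<sigma>\<close> or its
  inverse, and both actions fix zero.\<close>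

lemma dioph_gd_gal_act_eq_zero_iff:
  fixes z :: "('k::field_char_0, complex) tuple"
  assumes K: "finite_galois_over_rat TYPE('k)" and \<sigma>: "\<sigma> \<in> Gal"
    and ext: "\<mu> \<in> extensional Emb" "\<nu> \<in> extensional Emb" "z \<in> extensional Emb"
  shows "dioph_gd U (gal_act \<sigma> \<mu>) (gal_act \<sigma> \<nu>) (gal_act \<sigma> z) = {ustd U (mink_embed 0)} \<longleftrightarrow>
    dioph_gd U \<mu> \<nu> z = {ustd U (mink_embed 0)}" (is "?D' = {?z} \<longleftrightarrow> ?D = {?z}")
proof
  have ext': "gal_act \<sigma> \<mu> \<in> extensional Emb" "gal_act \<sigma> \<nu> \<in> extensional Emb"
    "gal_act \<sigma> z \<in> extensional Emb"
    by (simp_all add: gal_act_def)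
  have D: "?D = star_gal_act U (inv_into UNIV \<sigma>) ` ?D'"
    using star_gal_act_image_dioph_gd[OF K Gal_inv[OF \<sigma>] ext', of U]
    by (simp add: gal_act_inv[OF \<sigma>] ext)
  show "?D = {?z}" if "?D' = {?z}"
    unfolding D that by (simp add: star_gal_act_zero Gal_inv[OF \<sigma>])
  show "?D' = {?z}" if "?D = {?z}"
    unfolding star_gal_act_image_dioph_gd[OF K \<sigma> ext, symmetric] that
    by (simp add: star_gal_act_zero[OF \<sigma>])
qed

lemma composable_gal_act:
  fixes z w :: "('k::field_char_0, complex) tuple"
  assumes U: "nonprincipal_ultrafilter U" and K: "finite_galois_over_rat TYPE('k)" and \<sigma>: "\<sigma> \<in> Gal"
    and zw: "z \<in> Mink" "w \<in> Mink" and \<mu>\<nu>: "\<mu> \<in> PK_Neps U" "\<nu> \<in> PK_Neps U"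
  shows "composable U (gal_act \<sigma> \<mu>) (gal_act \<sigma> \<nu>) (gal_act \<sigma> z) (gal_act \<sigma> w) \<longleftrightarrow>
    composable U \<mu> \<nu> z w"
  using zw \<mu>\<nu>
  by (simp add: composable_def gal_act_Mink[OF \<sigma>] gal_act_PK_Neps[OF U \<sigma>]
      dioph_gd_gal_act_eq_zero_iff[OF K \<sigma>] extensional_Mink extensional_PK_Neps)

text \<open>The memberships that the equivalence asks for are read off from
  \<open>composable\<close> itself.\<close>

lemma composable_gal_actI:
  fixes z w :: "('k::field_char_0, complex) tuple"
  assumes "nonprincipal_ultrafilter U" "finite_galois_over_rat TYPE('k)" "\<sigma> \<in> Gal"
    and "composable U \<mu> \<nu> z w"
  shows "composable U (gal_act \<sigma> \<mu>) (gal_act \<sigma> \<nu>) (gal_act \<sigma> z) (gal_act \<sigma> w)"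
  using assms composable_gal_act[OF assms(1-3)] by (simp add: composable_def)

text \<open>Each status is composability together with an order relation or an equality between the
  growth tuples; the order is invariant under the action, and equal tuples have equal
  images.\<close>

lemma divisor_at_gal_act:
  fixes z w :: "('k::field_char_0, complex) tuple"
  assumes "nonprincipal_ultrafilter U" "finite_galois_over_rat TYPE('k)" "\<sigma> \<in> Gal"
  shows fast_divisor_at_gal_act: "fast_divisor_at U \<mu> \<nu> z w \<Longrightarrow>
      fast_divisor_at U (gal_act \<sigma> \<mu>) (gal_act \<sigma> \<nu>) (gal_act \<sigma> z) (gal_act \<sigma> w)"
    and slow_divisor_at_gal_act: "slow_divisor_at U \<mu> \<nu> z w \<Longrightarrow>
      slow_divisor_at U (gal_act \<sigma> \<mu>) (gal_act \<sigma> \<nu>) (gal_act \<sigma> z) (gal_act \<sigma> w)"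
    and flat_divisor_at_gal_act: "flat_divisor_at U \<mu> \<nu> z w \<Longrightarrow>
      flat_divisor_at U (gal_act \<sigma> \<mu>) (gal_act \<sigma> \<nu>) (gal_act \<sigma> z) (gal_act \<sigma> w)"
    and oscillatory_divisor_at_gal_act: "oscillatory_divisor_at U \<mu> \<nu> z w \<Longrightarrow>
      oscillatory_divisor_at U (gal_act \<sigma> \<mu>) (gal_act \<sigma> \<nu>) (gal_act \<sigma> z) (gal_act \<sigma> w)"
  using composable_gal_actI[OF assms]
  unfolding fast_divisor_at_def slow_divisor_at_def flat_divisor_at_def
    oscillatory_divisor_at_def PK_le_gal_act[OF assms(3)] PK_less_gal_act[OF assms(3)]
  by fast+

text \<open>The cofactor and both growth tuples witnessing the status are moved by
  \<open>\<sigma>\<close>; multiplicativity of the action identifies the new product.\<close>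

lemma divisor_gal_act:
  fixes z x :: "('k::field_char_0, complex) tuple"
  assumes "nonprincipal_ultrafilter U" "finite_galois_over_rat TYPE('k)" "\<sigma> \<in> Gal"
  shows fast_divisor_gal_act:
      "fast_divisor U z x \<Longrightarrow> fast_divisor U (gal_act \<sigma> z) (gal_act \<sigma> x)"
    and slow_divisor_gal_act:
      "slow_divisor U z x \<Longrightarrow> slow_divisor U (gal_act \<sigma> z) (gal_act \<sigma> x)"
    and flat_divisor_gal_act:
      "flat_divisor U z x \<Longrightarrow> flat_divisor U (gal_act \<sigma> z) (gal_act \<sigma> x)"
    and oscillatory_divisor_gal_act:
      "oscillatory_divisor U z x \<Longrightarrow> oscillatory_divisor U (gal_act \<sigma> z) (gal_act \<sigma> x)"
  unfolding fast_divisor_def slow_divisor_def flat_divisor_def oscillatory_divisor_def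
  by (blast intro: divisor_at_gal_act[OF assms] gal_act_mink_mult[OF assms(3)])+

theorem theorem33:
  fixes U :: "nat filter" and \<sigma> :: "'k::field_char_0 \<Rightarrow> 'k"
  assumes "nonprincipal_ultrafilter U"
    and "finite_galois_over_rat TYPE('k)"
    and "\<sigma> \<in> Gal"
  shows
    "(\<forall>z\<in>Mink. \<forall>\<mu>\<in>PK_Neps U. \<forall>\<nu>\<in>PK_Neps U. \<forall>\<iota>\<in>PK_Neps U.
        star_gal_act U \<sigma> ` dioph_gd_fine U \<mu> \<iota> \<nu> z =
          dioph_gd_fine U (gal_act \<sigma> \<mu>) (gal_act \<sigma> \<iota>) (gal_act \<sigma> \<nu>) (gal_act \<sigma> z)) \<and>
     (\<forall>z\<in>Mink. \<forall>w\<in>Mink. \<forall>\<mu>\<in>PK_Neps U. \<forall>\<nu>\<in>PK_Neps U.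
        (composable U \<mu> \<nu> z w \<longleftrightarrow>
          composable U (gal_act \<sigma> \<mu>) (gal_act \<sigma> \<nu>) (gal_act \<sigma> z) (gal_act \<sigma> w)) \<and>
        (\<forall>\<alpha>\<in>star_O U. \<forall>\<beta>\<in>star_O U.
          (\<alpha> \<in> dioph_gd U \<mu> \<nu> z \<and> \<beta> \<in> dioph_gd U \<nu> \<mu> w \<longleftrightarrow>
            star_gal_act U \<sigma> \<alpha> \<in> dioph_gd U (gal_act \<sigma> \<mu>) (gal_act \<sigma> \<nu>) (gal_act \<sigma> z) \<and>
            star_gal_act U \<sigma> \<beta> \<in> dioph_gd U (gal_act \<sigma> \<nu>) (gal_act \<sigma> \<mu>) (gal_act \<sigma> w))) \<and>
        (fast_divisor_at U \<mu> \<nu> z w \<longrightarrow>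
          fast_divisor_at U (gal_act \<sigma> \<mu>) (gal_act \<sigma> \<nu>) (gal_act \<sigma> z) (gal_act \<sigma> w)) \<and>
        (slow_divisor_at U \<mu> \<nu> z w \<longrightarrow>
          slow_divisor_at U (gal_act \<sigma> \<mu>) (gal_act \<sigma> \<nu>) (gal_act \<sigma> z) (gal_act \<sigma> w)) \<and>
        (flat_divisor_at U \<mu> \<nu> z w \<longrightarrow>
          flat_divisor_at U (gal_act \<sigma> \<mu>) (gal_act \<sigma> \<nu>) (gal_act \<sigma> z) (gal_act \<sigma> w)) \<and>
        (oscillatory_divisor_at U \<mu> \<nu> z w \<longrightarrow>
          oscillatory_divisor_at U (gal_act \<sigma> \<mu>) (gal_act \<sigma> \<nu>) (gal_act \<sigma> z) (gal_act \<sigma> w))) \<and>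
     (\<forall>z\<in>Mink. \<forall>w\<in>Mink.
        (fast_divisor U z (mink_mult z w) \<longrightarrow>
          fast_divisor U (gal_act \<sigma> z) (mink_mult (gal_act \<sigma> z) (gal_act \<sigma> w))) \<and>
        (slow_divisor U z (mink_mult z w) \<longrightarrow>
          slow_divisor U (gal_act \<sigma> z) (mink_mult (gal_act \<sigma> z) (gal_act \<sigma> w))) \<and>
        (flat_divisor U z (mink_mult z w) \<longrightarrow>
          flat_divisor U (gal_act \<sigma> z) (mink_mult (gal_act \<sigma> z) (gal_act \<sigma> w))) \<and>
        (oscillatory_divisor U z (mink_mult z w) \<longrightarrow>
          oscillatory_divisor U (gal_act \<sigma> z) (mink_mult (gal_act \<sigma> z) (gal_act \<sigma> w))))"
proof -
  note ext = extensional_Mink extensional_PK_Neps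
  show ?thesis
    \<comment> \<open>The product of the moved factors is folded into the moved product, the form in
      which \<open>divisor_gal_act\<close> applies.\<close>
    unfolding gal_act_mink_mult[OF assms(3), symmetric]
    \<comment> \<open>The optional rule leaves open the equivalence for \<open>\<alpha>\<close> and
      \<open>\<beta>\<close> and the side conditions of the rules; the final simplification settles
      them by extensionality.\<close>
    by (intro conjI ballI impI;
        (rule star_gal_act_image_dioph_gd_fine[OF assms(2,3)]
          composable_gal_act[OF assms, symmetric] divisor_at_gal_act[OF assms]
          divisor_gal_act[OF assms])?)
      (simp_all add: ext star_gal_act_dioph_gd_iff[OF assms(2,3)])
qed

end
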